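(* Consider the nondeterministic Algorithm 1 described in the context. It always correctly constructs a weakly infeasible SDP (that is, its steps can be carried out and, whatever choices are made in them, the output is a weakly infeasible SDP of the form $(P)$), and any weakly infeasible SDP of the form $$A_i\bullet X=b_i\ (i=1,\dots,m),\quad X\in\mathcal{S}^n_+ \qquad (P)$$ is among its outputs (that is, it is produced by Algorithm 1 for some choices).
   Context: $\mathcal{S}^n$ is the space of real symmetric $n\times n$ matrices, $\mathcal{S}^n_+$ the cone of positive semidefinite ones, $A\bullet X=\operatorname{trace}(AX)$, $N=\{1,\dots,n\}$. For a matrix $M$ and $R,S\subseteq N$, $M(R,S)$ is the submatrix with rows in $R$ and columns in $S$, and $M(R)=M(R,R)$. Weak infeasibility: $(P)$ (with data $A_i\in\mathcal{S}^n$, $b\in\mathbb{R}^m$) is weakly infeasible if it has no feasible solution, but the affine set $\{X\in\mathcal{S}^n: A_i\bullet X=b_i\ \forall i\}$ has zero distance to $\mathcal{S}^n_+$ (the distance from an empty set being $+\infty$). Reformulation: to reformulate $(P)$ means to apply finitely many (possibly none) of the following operations, in any order: (1) exchange $(A_i,b_i)$ and $(A_j,b_j)$ for distinct $i,j$; (2) replace $(A_i,b_i)$ by $\lambda(A_i,b_i)+\mu(A_j,b_j)$, where $i\ne j$, $\lambda,\mu\in\mathbb{R}$, $\lambda\neq 0$; (3) replace all $A_i$ by $T^\top A_iT$, where $T$ is an invertible real $n\times n$ matrix. Semidefinite echelon form: a sequence $(M_1,\dots,M_k)$ of matrices in $\mathcal{S}^n$ is in semidefinite echelon form with structure $\{P_1,\dots,P_k\}$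 if the $P_i$ are disjoint (possibly empty) subsets of $N$ and, for each $i$: $M_i(P_i)$ is diagonal with positive diagonal entries; $M_i(P_1\cup\dots\cup P_{i-1},N)$, and by symmetry its transpose, is arbitrary; and all remaining entries of $M_i$ are zero. Base equations for $(A_1,\dots,A_{k+1})$ and $(X_1,\dots,X_{\ell+1})$: $A_i\bullet X_j=0$ if $(i,j)\neq(k+1,\ell+1)$, and $A_{k+1}\bullet X_{\ell+1}=-1$. Algorithm 1 (Construct Weakly Infeasible SDP): Step 1. Choose positive integers $m,k,\ell$ with $k+1\le m$. Choose $(A_1,\dots,A_{k+1})$ and $(X_1,\dots,X_{\ell+1})$ in $\mathcal{S}^n$, in semidefinite echelon form, which satisfy the base equations; this is done by Algorithm 2 below. Step 2. Let $(b_1,\dots,b_k,b_{k+1})=(0,\dots,0,-1)$. Step 3. Choose $A_{k+2},\dots,A_m\in\mathcal{S}^n$ having zero $\bullet$ product with $X_1,\dots,X_\ell$. Step 4. Set $b_i:=A_i\bullet X_{\ell+1}$ for $i=k+2,\dots,m$. Step 5. Reformulate the SDP with data $(A_1,\dots,A_m)$, $b$; output the result. Algorithm 2 (Base Equations Algorithm): Step 1. Choose $(A_i)_{i=1}^{k+1}$ and $(X_j)_{j=1}^{\ell+1}$ in semidefinite echelon form with structures $\{P_i\}_{i=1}^{k+1}$ and $\{Q_j\}_{j=1}^{\ell+1}$ respectively, such that $P_1,\dots,P_k,Q_1,\dots,Q_\ell$ are all nonempty, $P_1\cap(Q_1\cup\dots\cup Q_{\ell+1})=\emptyset$ and $Q_1\cap(P_1\cup\dots\cup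 P_{k+1})=\emptyset$. Step 2. For $i=2,\dots,k+1$ in order: reset the blocks $A_i(P_{i-1},Q_1),X_2(P_{i-1},Q_1),\dots,X_{\ell+1}(P_{i-1},Q_1)$ (and, symmetrically, the transposed $(Q_1,P_{i-1})$ blocks) to any values such that the base equations with left hand sides $A_i\bullet X_2,\dots,A_i\bullet X_{\ell+1}$ hold. *)

theory Defs
  imports "HOL-Analysis.Analysis"
begin

text \<open>The order \<open>n\<close> of the matrices is \<open>CARD('n)\<close>, and the index set \<open>N\<close> is \<open>UNIV :: 'n set\<close>.
  The distance on \<open>real^'n^'n\<close> is the one induced by the Frobenius norm.\<close>

definition sym_mat :: "real^'n^'n \<Rightarrow> bool" where
  "sym_mat M \<longleftrightarrow> transpose M = M"

definition psd_cone :: "(real^'n^'n) set" where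
  "psd_cone = {X. sym_mat X \<and> (\<forall>v. 0 \<le> v \<bullet> (X *v v))}"

definition mat_prod :: "real^'n^'n \<Rightarrow> real^'n^'n \<Rightarrow> real" (infix \<open>\<bullet>\<^sub>S\<close> 70) where
  "A \<bullet>\<^sub>S X = trace (A ** X)"

section \<open>Semidefinite systems\<close>

text \<open>The data \<open>(A\<^sub>1, b\<^sub>1), \<dots>, (A\<^sub>m, b\<^sub>m)\<close> of a semidefinite system, as a list of length \<open>m\<close>.\<close>

type_synonym 'n sdp = "((real^'n^'n) \<times> real) list"

definition is_sdp :: "('n::finite) sdp \<Rightarrow> bool" where
  "is_sdp p \<longleftrightarrow> (\<forall>(A, b) \<in> set p. sym_mat A)"

definition affine_set :: "('n::finite) sdp \<Rightarrow> (real^'n^'n) set" where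
  "affine_set p = {X. sym_mat X \<and> (\<forall>(A, b) \<in> set p. A \<bullet>\<^sub>S X = b)}"

text \<open>The library's \<open>setdist\<close> to the empty set is \<open>0\<close> rather than \<open>\<infinity>\<close>, so
  nonemptiness has to be required separately.\<close>

definition weakly_infeasible :: "('n::finite) sdp \<Rightarrow> bool" where
  "weakly_infeasible p \<longleftrightarrow>
     affine_set p \<inter> psd_cone = {} \<and> affine_set p \<noteq> {} \<and> setdist (affine_set p) psd_cone = 0"

inductive reform_step :: "('n::finite) sdp \<Rightarrow> 'n sdp \<Rightarrow> bool" where
  exchange: "\<lbrakk>i < length p; j < length p; i \<noteq> j\<rbrakk> \<Longrightarrow> reform_step p (p[i := p ! j, j := p ! i])"
| combine: "\<lbrakk>i < length p; j < length p; i \<noteq> j; lam \<noteq> 0\<rbrakk>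
    \<Longrightarrow> reform_step p (p[i := lam *\<^sub>R (p ! i) + mu *\<^sub>R (p ! j)])"
| congruence: "invertible T
    \<Longrightarrow> reform_step p (map (\<lambda>(A, b). (transpose T ** A ** T, b)) p)"

definition reformulation :: "('n::finite) sdp \<Rightarrow> 'n sdp \<Rightarrow> bool" where
  "reformulation = reform_step\<^sup>*\<^sup>*"

section \<open>Echelon form and base equations\<close>

text \<open>Below, a sequence \<open>(M\<^sub>1, \<dots>, M\<^sub>k)\<close> is a function on \<open>nat\<close> of which only the values on
  \<open>{1..k}\<close> matter; likewise for a structure \<open>(P\<^sub>1, \<dots>, P\<^sub>k)\<close>.\<close>

definition echelon_struct :: "nat \<Rightarrow> (nat \<Rightarrow> real^'n^'n) \<Rightarrow> (nat \<Rightarrow> 'n set) \<Rightarrow> bool" where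
  "echelon_struct k M P \<longleftrightarrow>
     disjoint_family_on P {1..k} \<and>
     (\<forall>i\<in>{1..k}.
        sym_mat (M i) \<and>
        (\<forall>r\<in>P i. \<forall>s\<in>P i. r \<noteq> s \<longrightarrow> M i $ r $ s = 0) \<and>
        (\<forall>r\<in>P i. 0 < M i $ r $ r) \<and>
        (\<forall>r s. r \<notin> (\<Union>j\<in>{1..<i}. P j) \<and> s \<notin> (\<Union>j\<in>{1..<i}. P j) \<and> \<not> (r \<in> P i \<and> s \<in> P i)
           \<longrightarrow> M i $ r $ s = 0))"

definition echelon :: "nat \<Rightarrow> (nat \<Rightarrow> real^'n^'n) \<Rightarrow> bool" where
  "echelon k M \<longleftrightarrow> (\<exists>P. echelon_struct k M P)"

definition base_eq ::
    "nat \<Rightarrow> nat \<Rightarrow> (nat \<Rightarrow> real^'n^'n) \<Rightarrow> (nat \<Rightarrow> real^'n^'n) \<Rightarrow> nat \<Rightarrow> nat \<Rightarrow> bool" where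
  "base_eq k l A X i j \<longleftrightarrow> A i \<bullet>\<^sub>S X j = (if (i, j) = (k + 1, l + 1) then - 1 else 0)"

definition base_eqs ::
    "nat \<Rightarrow> nat \<Rightarrow> (nat \<Rightarrow> real^'n^'n) \<Rightarrow> (nat \<Rightarrow> real^'n^'n) \<Rightarrow> bool" where
  "base_eqs k l A X \<longleftrightarrow> (\<forall>i\<in>{1..k + 1}. \<forall>j\<in>{1..l + 1}. base_eq k l A X i j)"

section \<open>The Base Equations Algorithm\<close>

definition bea_init :: "nat \<Rightarrow> nat \<Rightarrow> (nat \<Rightarrow> 'n set) \<Rightarrow> (nat \<Rightarrow> 'n set) \<Rightarrow>
    (nat \<Rightarrow> real^'n^'n) \<Rightarrow> (nat \<Rightarrow> real^'n^'n) \<Rightarrow> bool" where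
  "bea_init k l P Q A X \<longleftrightarrow>
     echelon_struct (k + 1) A P \<and> echelon_struct (l + 1) X Q \<and>
     (\<forall>i\<in>{1..k}. P i \<noteq> {}) \<and> (\<forall>j\<in>{1..l}. Q j \<noteq> {}) \<and>
     P 1 \<inter> (\<Union>j\<in>{1..l + 1}. Q j) = {} \<and> Q 1 \<inter> (\<Union>i\<in>{1..k + 1}. P i) = {}"

text \<open>\<open>M'\<close> arises from \<open>M\<close> by resetting the blocks \<open>M(R,S)\<close> and, symmetrically, \<open>M(S,R)\<close>.\<close>

definition reset_block :: "'n set \<Rightarrow> 'n set \<Rightarrow> real^'n^'n \<Rightarrow> real^'n^'n \<Rightarrow> bool" where
  "reset_block R S M M' \<longleftrightarrow> sym_mat M' \<and>
     (\<forall>r s. \<not> (r \<in> R \<and> s \<in> S) \<and> \<not> (r \<in> S \<and> s \<in> R) \<longrightarrow> M' $ r $ s = M $ r $ s)"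

definition bea_iter :: "nat \<Rightarrow> nat \<Rightarrow> (nat \<Rightarrow> 'n set) \<Rightarrow> (nat \<Rightarrow> 'n set) \<Rightarrow> nat \<Rightarrow>
    (nat \<Rightarrow> real^'n^'n) \<Rightarrow> (nat \<Rightarrow> real^'n^'n) \<Rightarrow>
    (nat \<Rightarrow> real^'n^'n) \<Rightarrow> (nat \<Rightarrow> real^'n^'n) \<Rightarrow> bool" where
  "bea_iter k l P Q i A X A' X' \<longleftrightarrow>
     reset_block (P (i - 1)) (Q 1) (A i) (A' i) \<and> (\<forall>h. h \<noteq> i \<longrightarrow> A' h = A h) \<and>
     (\<forall>j\<in>{2..l + 1}. reset_block (P (i - 1)) (Q 1) (X j) (X' j)) \<and>
     (\<forall>j. j \<notin> {2..l + 1} \<longrightarrow> X' j = X j) \<and>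
     (\<forall>j\<in>{2..l + 1}. base_eq k l A' X' i j)"

text \<open>\<open>bea_run k l P Q t A X\<close>: the algorithm, having chosen the structures \<open>P\<close> and \<open>Q\<close>, can
  hold \<open>A\<close> and \<open>X\<close> after the iterations \<open>i = 2, \<dots>, t\<close> of its loop.\<close>

inductive bea_run :: "nat \<Rightarrow> nat \<Rightarrow> (nat \<Rightarrow> 'n set) \<Rightarrow> (nat \<Rightarrow> 'n set) \<Rightarrow> nat \<Rightarrow>
    (nat \<Rightarrow> real^'n^'n) \<Rightarrow> (nat \<Rightarrow> real^'n^'n) \<Rightarrow> bool"
  for k l P Q where
  init: "bea_init k l P Q A X \<Longrightarrow> bea_run k l P Q 1 A X"
| iter: "\<lbrakk>bea_run k l P Q t A X; t + 1 \<le> k + 1; bea_iter k l P Q (t + 1) A X A' X'\<rbrakk>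
    \<Longrightarrow> bea_run k l P Q (t + 1) A' X'"

definition bea_output ::
    "nat \<Rightarrow> nat \<Rightarrow> (nat \<Rightarrow> real^'n^'n) \<Rightarrow> (nat \<Rightarrow> real^'n^'n) \<Rightarrow> bool" where
  "bea_output k l A X \<longleftrightarrow> (\<exists>P Q. bea_run k l P Q (k + 1) A X)"

section \<open>Construction of weakly infeasible systems\<close>

definition wi_step1 :: "nat \<Rightarrow> nat \<Rightarrow> nat \<Rightarrow> (nat \<Rightarrow> real^'n^'n) \<Rightarrow> (nat \<Rightarrow> real^'n^'n) \<Rightarrow> bool" where
  "wi_step1 m k l A X \<longleftrightarrow> 1 \<le> m \<and> 1 \<le> k \<and> 1 \<le> l \<and> k + 1 \<le> m \<and> bea_output k l A X"

text \<open>The sequence \<open>A'\<close> extends \<open>(A\<^sub>1, \<dots>, A\<^sub>k\<^sub>+\<^sub>1)\<close> by the newly chosen \<open>A\<^sub>k\<^sub>+\<^sub>2, \<dots>, A\<^sub>m\<close>.\<close>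

definition wi_step3 :: "nat \<Rightarrow> nat \<Rightarrow> nat \<Rightarrow> (nat \<Rightarrow> real^'n^'n) \<Rightarrow> (nat \<Rightarrow> real^'n^'n) \<Rightarrow>
    (nat \<Rightarrow> real^'n^'n) \<Rightarrow> bool" where
  "wi_step3 m k l A X A' \<longleftrightarrow>
     (\<forall>i\<in>{1..k + 1}. A' i = A i) \<and>
     (\<forall>i\<in>{k + 2..m}. sym_mat (A' i) \<and> (\<forall>j\<in>{1..l}. A' i \<bullet>\<^sub>S X j = 0))"

definition wi_rhs ::
    "nat \<Rightarrow> nat \<Rightarrow> (nat \<Rightarrow> real^'n^'n) \<Rightarrow> (nat \<Rightarrow> real^'n^'n) \<Rightarrow> nat \<Rightarrow> real" where
  "wi_rhs k l A X i = (if i \<le> k then 0 else if i = k + 1 then - 1 else A i \<bullet>\<^sub>S X (l + 1))"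

definition wi_data ::
    "nat \<Rightarrow> nat \<Rightarrow> nat \<Rightarrow> (nat \<Rightarrow> real^'n^'n) \<Rightarrow> (nat \<Rightarrow> real^'n^'n) \<Rightarrow> 'n sdp" where
  "wi_data m k l A X = map (\<lambda>i. (A i, wi_rhs k l A X i)) [1..<m + 1]"

definition wi_output :: "('n::finite) sdp \<Rightarrow> bool" where
  "wi_output p \<longleftrightarrow> (\<exists>m k l A X A'.
     wi_step1 m k l A X \<and> wi_step3 m k l A X A' \<and> reformulation (wi_data m k l A' X) p)"

end

theory Submission
  imports Defs
begin

text \<open>Weak infeasibility is certified from both sides. Facial reduction of \<open>(P)\<close> yields matrices
  \<open>A\<^sub>1, \<dots>, A\<^sub>k\<^sub>+\<^sub>1\<close> in the span of the constraints, each positive semidefinite on the common radical of its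
  predecessors, which refute feasibility; facial reduction in the space of \<open>X\<close> yields directions
  \<open>X\<^sub>1, \<dots>, X\<^sub>l\<close> of the affine set and a point \<open>X\<^sub>l\<^sub>+\<^sub>1\<close> of it, which show that it comes arbitrarily close to
  the cone. The radicals form a flag in \<open>\<real>\<^sup>n\<close> and a flag in its dual. As in the Bruhat decomposition, some
  pair of dual bases is adapted to both flags, and it can be chosen to diagonalize all the forms induced on the
  graded pieces: this is a simultaneous echelon form. The base equations hold automatically, because the \<open>A\<^sub>i\<close> are
  combinations of the constraints; with the echelon form they make \<open>P\<^sub>1\<close> disjoint from all \<open>Q\<^sub>j\<close> and \<open>Q\<^sub>1\<close>
  disjoint from all \<open>P\<^sub>i\<close>, so the Base Equations Algorithm may start with the final matrices and leave them
  unchanged.\<close>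

section \<open>Quadratic forms on subspaces\<close>

text \<open>A congruence of the \<open>A i\<close> by \<open>T\<close> preserves all products with
  the \<open>X j\<close> only if these undergo the congruence by the inverse transpose of
  \<open>T\<close>. The two echelon forms must therefore come from dual bases and cannot be sought
  independently. Adaptedness to both flags alone gives the zero blocks but not the diagonal ones:
  where a graded piece of one flag meets one of the other, two positive definite forms, one of them
  through duality, have to become diagonal in a single basis, a generalized eigenvalue problem.
  Strict descent of the flags makes the blocks nonempty. In the converse direction, the equations
  with right-hand side 0 clear the rows of a positive semidefinite solution block by block, until
  its product with \<open>A (k + 1)\<close> is nonnegative and cannot be -1. Large multiples of
  \<open>X l\<close>, then of \<open>X (l - 1)\<close>, and so on, added to
  \<open>X (l + 1)\<close>, leave a negative part that can be made as small as desired.\<close>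

lemma sym_mat_inner:
  assumes "sym_mat M"
  shows "v \<bullet> (M *v w) = w \<bullet> (M *v v)"
proof -
  have "v \<bullet> (M *v w) = (v v* M) \<bullet> w" by (simp only: dot_lmul_matrix)
  also have "v v* M = transpose M *v v" by (simp only: transpose_matrix_vector)
  also have "transpose M = M" using assms by (simp only: sym_mat_def)
  finally show ?thesis by (simp only: inner_commute)
qed

lemma sym_mat_iff: "sym_mat M \<longleftrightarrow> (\<forall>r s. M $ r $ s = M $ s $ r)"
  by (auto simp: sym_mat_def transpose_def vec_eq_iff)

lemma sym_mat_entry: "sym_mat M \<Longrightarrow> M $ r $ s = M $ s $ r"
  unfolding sym_mat_iff by blast

lemma sym_mat_0: "sym_mat 0" and sym_mat_1: "sym_mat (mat 1)"
  by (auto simp: sym_mat_iff mat_def)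

lemma sym_mat_add: "sym_mat A \<Longrightarrow> sym_mat B \<Longrightarrow> sym_mat (A + B)"
  and sym_mat_diff: "sym_mat A \<Longrightarrow> sym_mat B \<Longrightarrow> sym_mat (A - B)"
  and sym_mat_scaleR: "sym_mat A \<Longrightarrow> sym_mat (c *\<^sub>R A)"
  by (auto simp: sym_mat_iff)

lemma subspace_sym_mat: "subspace {M. sym_mat M}"
  by (auto simp: subspace_def sym_mat_0 sym_mat_add sym_mat_scaleR)

lemma sym_mat_congruence: "sym_mat A \<Longrightarrow> sym_mat (transpose T ** A ** T)"
  by (simp add: sym_mat_def matrix_transpose_mul transpose_transpose matrix_mul_assoc)

lemma scaleR_matrix_vector: "(c *\<^sub>R A) *v v = c *\<^sub>R (A *v v)" for A :: "real^'n^'m"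
  by (simp add: vec_eq_iff matrix_vector_mult_def sum_distrib_left mult.assoc)

lemma inner_congruence: "v \<bullet> ((transpose T ** A ** T) *v w) = (T *v v) \<bullet> (A *v (T *v w))"
  for A T :: "real^'n^'n"
proof -
  have "v \<bullet> ((transpose T ** A ** T) *v w) = v \<bullet> (transpose T *v (A *v (T *v w)))"
    by (simp only: matrix_vector_mul_assoc matrix_mul_assoc)
  also have "\<dots> = (v v* transpose T) \<bullet> (A *v (T *v w))"
    by (simp only: dot_lmul_matrix)
  finally show ?thesis by (simp only: vector_transpose_matrix)
qed

definition psd_on :: "(real^'n) set \<Rightarrow> real^'n^'n \<Rightarrow> bool" where
  "psd_on S M \<longleftrightarrow> (\<forall>v\<in>S. 0 \<le> v \<bullet> (M *v v))"

lemma psd_onD: "psd_on S M \<Longrightarrow> v \<in> S \<Longrightarrow> 0 \<le> v \<bullet> (M *v v)"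
  by (simp add: psd_on_def)

lemma psd_on_mono: "psd_on S M \<Longrightarrow> T \<subseteq> S \<Longrightarrow> psd_on T M"
  by (auto simp: psd_on_def)

lemma psd_cone_iff: "M \<in> psd_cone \<longleftrightarrow> sym_mat M \<and> psd_on UNIV M"
  by (simp add: psd_cone_def psd_on_def)

text \<open>Along \<open>v + t *\<^sub>R w\<close> the form has no constant term, so a nonzero
  linear coefficient would make it negative for small \<open>t\<close> of the right sign. Hence the
  null vectors of a form that is positive semidefinite on \<open>S\<close> make up its radical
  there.\<close>

lemma psd_on_null:
  assumes "subspace S" "sym_mat M" "psd_on S M" "v \<in> S" "v \<bullet> (M *v v) = 0" "w \<in> S"
  shows "w \<bullet> (M *v v) = 0"
proof (rule ccontr)
  define b where "b = w \<bullet> (M *v v)"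
  define c where "c = w \<bullet> (M *v w)"
  assume "w \<bullet> (M *v v) \<noteq> 0"
  then have b: "b \<noteq> 0" by (simp add: b_def)
  have c: "0 \<le> c" using assms by (simp add: psd_on_def c_def)
  have key: "0 \<le> 2 * t * b + t^2 * c" for t
  proof -
    have "v + t *\<^sub>R w \<in> S" using assms by (simp add: subspace_add subspace_scale)
    then have "0 \<le> (v + t *\<^sub>R w) \<bullet> (M *v (v + t *\<^sub>R w))"
      using assms(3) by (simp add: psd_on_def)
    also have "\<dots> = 2 * t * b + t^2 * c"
      using assms(5) sym_mat_inner[OF assms(2), of v w]
      by (simp add: b_def c_def algebra_simps inner_add matrix_vector_mult_scaleR power2_eq_square)
    finally show ?thesis .
  qed
  \<comment> \<open>The natural choice of \<open>t\<close> is the minimizer \<open>- b / c\<close>;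
    the denominator \<open>c + 1\<close> also covers \<open>c = 0\<close>.\<close>
  have "2 * (- b / (c + 1)) * b + (- b / (c + 1))^2 * c = - ((b / (c + 1))^2 * (c + 2))"
  proof -
    define d where "d = b / (c + 1)"
    have "b = d * (c + 1)" using c by (simp add: d_def)
    moreover have "2 * (- d) * (d * (c + 1)) + (- d)^2 * c = - (d^2 * (c + 2))"
      by (simp add: algebra_simps power2_eq_square)
    ultimately show ?thesis by (simp add: d_def)
  qed
  moreover have "(b / (c + 1))^2 * (c + 2) > 0"
    using b c by simp
  ultimately show False using key[of "- b / (c + 1)"] by simp
qed

definition rad :: "(real^'n) set \<Rightarrow> real^'n^'n \<Rightarrow> (real^'n) set" where
  "rad S M = {v\<in>S. \<forall>w\<in>S. w \<bullet> (M *v v) = 0}"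

lemma subspace_rad:
  assumes "subspace S" shows "subspace (rad S M)"
  using assms by (auto simp: subspace_def rad_def matrix_vector_right_distrib inner_add matrix_vector_mult_scaleR)

lemma rad_subset: "rad S M \<subseteq> S"
  by (auto simp: rad_def)

lemma radI:
  "\<lbrakk>subspace S; sym_mat M; psd_on S M; v \<in> S; v \<bullet> (M *v v) = 0\<rbrakk> \<Longrightarrow> v \<in> rad S M"
  by (simp add: rad_def psd_on_null)

lemma radD: "v \<in> rad S M \<Longrightarrow> w \<in> S \<Longrightarrow> w \<bullet> (M *v v) = 0"
  by (simp add: rad_def)

primrec flag :: "(nat \<Rightarrow> real^'n^'n) \<Rightarrow> nat \<Rightarrow> (real^'n) set" where
  "flag M 0 = UNIV"
| "flag M (Suc i) = rad (flag M i) (M (Suc i))"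

lemma subspace_flag: "subspace (flag M i)"
  by (induction i) (auto intro: subspace_rad)

lemma flag_antimono: "i \<le> j \<Longrightarrow> flag M j \<subseteq> flag M i"
  by (rule lift_Suc_antimono_le) (simp_all add: rad_subset)

lemma flag_pred: "1 \<le> i \<Longrightarrow> flag M i = rad (flag M (i - 1)) (M i)"
  by (cases i) auto

lemma flag_cong: "(\<And>j. 1 \<le> j \<Longrightarrow> j \<le> i \<Longrightarrow> M j = M' j) \<Longrightarrow> flag M i = flag M' i"
  by (induction i) auto

text \<open>For a sequence in echelon form, \<open>flag M i\<close> is the space of the vectors
  vanishing on the first \<open>i\<close> sets of the structure. A facial reduction sequence is the
  same thing up to congruence, stated without coordinates.\<close>

definition fr_seq :: "nat \<Rightarrow> (nat \<Rightarrow> real^'n^'n) \<Rightarrow> bool" where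
  "fr_seq k M \<longleftrightarrow> (\<forall>i\<in>{1..k}. sym_mat (M i) \<and> psd_on (flag M (i - 1)) (M i))"

lemma fr_seqD:
  assumes "fr_seq k M" "i \<in> {1..k}"
  shows "sym_mat (M i)" "psd_on (flag M (i - 1)) (M i)"
  using assms(1)[unfolded fr_seq_def, THEN bspec, OF assms(2)] by simp_all

lemma flag_eqI:
  assumes "fr_seq k M" "i \<in> {1..k}" "v \<in> flag M (i - 1)" "v \<bullet> (M i *v v) = 0"
  shows "v \<in> flag M i"
proof -
  have "v \<in> rad (flag M (i - 1)) (M i)"
    by (rule radI[OF subspace_flag fr_seqD[OF assms(1,2)] assms(3,4)])
  moreover have "1 \<le> i" using assms(2) by simp
  ultimately show ?thesis by (simp only: flag_pred)
qed

lemma flag_orth: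
  assumes "1 \<le> i" "v \<in> flag M i" "w \<in> flag M (i - 1)"
  shows "w \<bullet> (M i *v v) = 0"
  using radD[of v "flag M (i - 1)" "M i" w] assms flag_pred[OF assms(1), of M] by blast

text \<open>Maximality of \<open>\<mu>\<close> makes \<open>\<mu> Q - H\<close> positive semidefinite on \<open>S\<close> with \<open>w\<close> a null vector, so \<open>w\<close>
  lies in its radical.\<close>

lemma generalized_eigenvector:
  fixes Q H :: "real^'n^'n"
  assumes S: "subspace S" and Q: "sym_mat Q" "psd_on S Q" and H: "sym_mat H" "psd_on S H"
    and null: "\<And>v. v \<in> S \<Longrightarrow> v \<bullet> (Q *v v) = 0 \<Longrightarrow> v \<bullet> (H *v v) = 0"
    and ex: "u \<in> S" "u \<bullet> (H *v u) \<noteq> 0"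
  obtains w \<mu> where "w \<in> S" "0 < \<mu>" "0 < w \<bullet> (Q *v w)"
    "\<And>v. v \<in> S \<Longrightarrow> v \<bullet> (H *v w) = \<mu> * (v \<bullet> (Q *v w))"
proof -
  define Z where "Z = rad S Q"
  have Z: "subspace Z" "Z \<subseteq> S" by (simp_all add: Z_def S subspace_rad rad_subset)
  \<comment> \<open>\<open>Q\<close> is definite on a complement of its radical \<open>Z\<close>, so
    the quotient of the forms is continuous on the unit sphere \<open>K\<close> there and attains
    its maximum. By \<open>null\<close>, both forms ignore the component in \<open>Z\<close>, so the
    bound by \<open>\<mu>\<close> extends to all of \<open>S\<close>.\<close>
  define S0 where "S0 = S \<inter> Z\<^sup>\<bottom>"
  have S0: "subspace S0" by (simp add: S0_def S subspace_orthogonal_comp subspace_inter)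
  have decomp: "\<exists>z s. z \<in> Z \<and> s \<in> S0 \<and> v = z + s" if "v \<in> S" for v
  proof -
    obtain z s where zs: "z \<in> span Z" "\<And>w. w \<in> span Z \<Longrightarrow> orthogonal s w" "v = z + s"
      using orthogonal_subspace_decomp_exists[of Z v] by blast
    have z: "z \<in> Z" using zs(1) span_eq_iff[of Z] Z(1) by blast
    moreover have "s \<in> S" using zs(3) z Z that S subspace_diff[OF S that, of z] by auto
    moreover have "s \<in> Z\<^sup>\<bottom>"
      using zs(2) by (auto simp: orthogonal_comp_def orthogonal_commute span_base)
    ultimately show ?thesis using zs(3) by (auto simp: S0_def)
  qed
  have Qpos: "0 < v \<bullet> (Q *v v)" if "v \<in> S0" "v \<noteq> 0" for v
  proof (rule ccontr)
    assume "\<not> 0 < v \<bullet> (Q *v v)"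
    then have "v \<bullet> (Q *v v) = 0" using Q that by (force simp: S0_def psd_on_def)
    then have "v \<in> Z" using that S Q by (simp add: Z_def radI S0_def)
    then have "orthogonal v v" using that by (auto simp: S0_def orthogonal_comp_def)
    with that show False by (simp add: orthogonal_self)
  qed
  have Zval: "(z + s) \<bullet> (M *v (z + s)) = s \<bullet> (M *v s)"
    if "sym_mat M" "psd_on S M" "z \<in> S" "z \<bullet> (M *v z) = 0" "s \<in> S" for M z s
  proof -
    have "s \<bullet> (M *v z) = 0" using psd_on_null[OF S that(1-4)] that by blast
    then show ?thesis using sym_mat_inner[OF that(1), of s z] that(4)
      by (simp add: matrix_vector_right_distrib inner_add)
  qed
  define h q where "h = (\<lambda>v. v \<bullet> (H *v v))" and "q = (\<lambda>v. v \<bullet> (Q *v v))"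
  have Znull: "z \<in> S \<and> q z = 0 \<and> h z = 0" if "z \<in> Z" for z
    using that Z null by (auto simp: q_def h_def Z_def rad_def)
  have same: "h (z + s) = h s \<and> q (z + s) = q s" if "z \<in> Z" "s \<in> S0" for z s
    using Znull[OF that(1)] that(2) Zval[OF H] Zval[OF Q] by (simp add: h_def q_def S0_def)
  obtain zu su where u: "zu \<in> Z" "su \<in> S0" "u = zu + su" using decomp ex by blast
  have hsu: "h su \<noteq> 0" using same[OF u(1,2)] u(3) ex by (simp add: h_def)
  then have su: "su \<noteq> 0" by (auto simp: h_def)
  define K where "K = S0 \<inter> sphere 0 1"
  have "compact K" unfolding K_def using closed_subspace[OF S0] by (intro closed_Int_compact) auto
  moreover have "(1 / norm su) *\<^sub>R su \<in> K" using u su S0 by (simp add: K_def subspace_scale)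
  moreover have "continuous_on K (\<lambda>v. h v / q v)"
  proof (intro continuous_on_divide)
    show "continuous_on K h" "continuous_on K q" unfolding h_def q_def
      by (intro continuous_intros matrix_vector_mult_linear_continuous_on)+
    show "\<forall>v\<in>K. q v \<noteq> 0" using Qpos by (force simp: K_def q_def)
  qed
  ultimately obtain w where w: "w \<in> K" "\<And>v. v \<in> K \<Longrightarrow> h v / q v \<le> h w / q w"
    using continuous_attains_sup[of K "\<lambda>v. h v / q v"] by blast
  define \<mu> where "\<mu> = h w / q w"
  have hom: "h (c *\<^sub>R v) = c^2 * h v" "q (c *\<^sub>R v) = c^2 * q v" for c v
    by (simp_all add: h_def q_def matrix_vector_mult_scaleR power2_eq_square)
  have le0: "h v \<le> \<mu> * q v" if "v \<in> S0" for v
  proof (cases "v = 0")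
    case False
    have "(1 / norm v) *\<^sub>R v \<in> K" using that False S0 by (simp add: K_def subspace_scale)
    from w(2)[OF this] have "h v / q v \<le> \<mu>" using False by (simp add: hom \<mu>_def)
    then show ?thesis using Qpos[OF that False] by (simp add: q_def field_simps)
  qed (simp add: h_def q_def)
  have le: "h v \<le> \<mu> * q v" if vS: "v \<in> S" for v
  proof -
    obtain z s where "z \<in> Z" "s \<in> S0" "v = z + s" using decomp[OF vS] by blast
    then show ?thesis using le0[of s] same[of z s] by simp
  qed
  have wS: "w \<in> S" "w \<in> S0" "w \<noteq> 0" using w by (auto simp: K_def S0_def)
  have qw: "0 < q w" using Qpos wS by (simp add: q_def)
  have "0 < h su" using hsu H u(2) by (force simp: h_def psd_on_def S0_def less_le)
  moreover have "0 < q su" using Qpos[OF u(2) su] by (simp add: q_def)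
  ultimately have \<mu>: "0 < \<mu>" using le0[OF u(2)] by (smt (verit) mult_nonpos_nonneg)
  define D where "D = \<mu> *\<^sub>R Q - H"
  have Dval: "x \<bullet> (D *v y) = \<mu> * (x \<bullet> (Q *v y)) - x \<bullet> (H *v y)" for x y
    by (simp add: D_def matrix_vector_mult_diff_rdistrib scaleR_matrix_vector inner_diff_right)
  have "v \<bullet> (D *v w) = 0" if "v \<in> S" for v
  proof (rule psd_on_null[OF S])
    show "sym_mat D" using Q H by (simp add: D_def sym_mat_diff sym_mat_scaleR)
    show "psd_on S D" using le by (simp add: psd_on_def Dval h_def q_def)
    show "w \<bullet> (D *v w) = 0" using qw by (simp add: Dval \<mu>_def h_def q_def)
  qed (use that wS in auto)
  then have "v \<bullet> (H *v w) = \<mu> * (v \<bullet> (Q *v w))" if "v \<in> S" for v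
    using that by (simp add: Dval)
  with that[of w \<mu>] wS(1) \<mu> qw show thesis by (simp add: q_def)
qed

section \<open>A basis adapted to two flags\<close>

text \<open>If \<open>e\<close> and \<open>f\<close> belong to dual bases, this says that, on \<open>flag M (a - 1)\<close>, the form \<open>M a\<close> is
  diagonal at \<open>e\<close>, with diagonal entry \<open>1 / c\<close>.\<close>

definition adapted :: "(nat \<Rightarrow> real^'n^'n) \<Rightarrow> nat \<Rightarrow> real^'n \<Rightarrow> real^'n \<Rightarrow> bool" where
  "adapted M a e f \<longleftrightarrow> e \<in> flag M (a - 1) \<and>
     (\<exists>c>0. \<forall>v\<in>flag M (a - 1). f \<bullet> v = c * (e \<bullet> (M a *v v)))"

lemma adapted_vanish:
  assumes "adapted M a e f" "1 \<le> a" "v \<in> flag M a"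
  shows "f \<bullet> v = 0"
proof -
  obtain c where c: "\<forall>v\<in>flag M (a - 1). f \<bullet> v = c * (e \<bullet> (M a *v v))" and e: "e \<in> flag M (a - 1)"
    using assms(1) by (auto simp: adapted_def)
  have "v \<in> flag M (a - 1)" using flag_antimono[of "a - 1" a M] assms(3) by auto
  moreover have "e \<bullet> (M a *v v) = 0" using flag_orth[OF assms(2,3) e] .
  ultimately show ?thesis using c by simp
qed

lemma adapted_orth:
  assumes M: "sym_mat (M i)" and ad: "adapted M a e f" and ai: "1 \<le> i" "i \<le> a"
    and x: "x \<in> flag M (i - 1)" "f \<bullet> x = 0"
  shows "x \<bullet> (M i *v e) = 0"
proof (cases "a = i")
  case True
  obtain c where "c > 0" "\<forall>v\<in>flag M (a - 1). f \<bullet> v = c * (e \<bullet> (M a *v v))"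
    using ad by (auto simp: adapted_def)
  then have "e \<bullet> (M i *v x) = 0" using x True by force
  then show ?thesis using sym_mat_inner[OF M, of e x] by simp
next
  case False
  then have "i \<le> a - 1" using ai by simp
  then have "e \<in> flag M i" using ad flag_antimono[of i "a - 1" M] unfolding adapted_def by blast
  then show ?thesis using flag_orth[OF ai(1)] x by blast
qed

text \<open>Whichever level is deeper, one factor vanishes: for \<open>i \<le> a\<close>,
  \<open>M i\<close> pairs \<open>e\<close> with \<open>x\<close> to zero; for \<open>a < i\<close>,
  \<open>f\<close> vanishes on \<open>flag M a\<close>, which contains \<open>v\<close>. This makes
  the projection along the pairs already chosen harmless for the form \<open>M i\<close>.\<close>

lemma adapted_proj:
  assumes M: "sym_mat (M i)" and ad: "adapted M a e f" and ai: "1 \<le> i" "1 \<le> a"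
    and x: "x \<in> flag M (i - 1)" "f \<bullet> x = 0" and v: "v \<in> flag M (i - 1)"
  shows "(f \<bullet> v) * (x \<bullet> (M i *v e)) = 0"
proof (cases "i \<le> a")
  case True
  then show ?thesis using adapted_orth[OF M ad ai(1) _ x] by simp
next
  case False
  then have "a \<le> i - 1" by simp
  then have "v \<in> flag M a" using flag_antimono v by blast
  then show ?thesis using adapted_vanish[OF ad ai(2)] by simp
qed

lemma flag_level_exists:
  assumes "flag M K = {0}" "w \<in> S" "w \<noteq> 0"
  obtains i u where "i \<in> {1..K}" "S \<subseteq> flag M (i - 1)" "u \<in> S" "u \<notin> flag M i"
proof -
  define i where "i = (LEAST i. \<not> S \<subseteq> flag M i)"
  have K: "\<not> S \<subseteq> flag M K" using assms by auto
  have i: "\<not> S \<subseteq> flag M i" unfolding i_def by (rule LeastI[of "\<lambda>i. \<not> S \<subseteq> flag M i", OF K])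
  then have "1 \<le> i" by (cases i) auto
  moreover have "i \<le> K" unfolding i_def using K by (rule Least_le)
  moreover have "S \<subseteq> flag M (i - 1)" using not_less_Least[of "i - 1" "\<lambda>i. \<not> S \<subseteq> flag M i"] \<open>1 \<le> i\<close>
    by (simp add: i_def[symmetric])
  ultimately show thesis using i that[of i] by auto
qed

text \<open>Let \<open>w\<close> be an eigenvector, on \<open>W\<close>, of the form \<open>w \<mapsto> g w \<bullet> A\<^sub>a (g w)\<close> relative to \<open>X\<^sub>b\<close>, where
  \<open>g = P X\<^sub>b\<close>. Then \<open>e = g w\<close> and \<open>f\<close>, proportional to \<open>P\<^sup>T A\<^sub>a e\<close>, extend the dual systems.\<close>

lemma adapted_dual_extend:
  fixes A X :: "nat \<Rightarrow> real^'n^'n" and e f :: "'n \<Rightarrow> real^'n"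
  assumes A: "fr_seq K A" "flag A K = {0}" and X: "fr_seq L X" "flag X L = {0}"
    and R: "R \<noteq> UNIV"
    and dual: "\<And>r s. r \<in> R \<Longrightarrow> s \<in> R \<Longrightarrow> f r \<bullet> e s = (if r = s then 1 else 0)"
    and adA: "\<And>r. r \<in> R \<Longrightarrow> 1 \<le> a r \<and> adapted A (a r) (e r) (f r)"
    and adX: "\<And>r. r \<in> R \<Longrightarrow> 1 \<le> b r \<and> adapted X (b r) (f r) (e r)"
  obtains i j x y where "i \<in> {1..K}" "j \<in> {1..L}" "adapted A i x y" "adapted X j y x" "y \<bullet> x = 1"
    "\<And>r. r \<in> R \<Longrightarrow> f r \<bullet> x = 0 \<and> y \<bullet> e r = 0"
proof -
  \<comment> \<open>\<open>P\<close> projects along the span of the chosen \<open>e r\<close> onto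
    the common kernel of the \<open>f r\<close>; \<open>P'\<close> is its transpose and maps into
    \<open>W\<close>. Projecting new vectors by them keeps the systems dual.\<close>
  define W where "W = {w. \<forall>r\<in>R. e r \<bullet> w = 0}"
  define P where "P = (\<lambda>v. v - (\<Sum>r\<in>R. (f r \<bullet> v) *\<^sub>R e r))"
  define P' where "P' = (\<lambda>v. v - (\<Sum>r\<in>R. (e r \<bullet> v) *\<^sub>R f r))"
  have W: "subspace W" by (auto simp: W_def subspace_def inner_add_right)
  have linP: "linear P" unfolding P_def
    by (intro linearI) (simp_all add: inner_add_right algebra_simps sum.distrib scaleR_sum_right)
  have adj: "x \<bullet> P v = P' x \<bullet> v" for x v
    by (simp add: P_def P'_def inner_diff_left inner_diff_right inner_sum_left inner_sum_right
        inner_commute mult.commute)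
  have fP: "f r \<bullet> P v = 0" if "r \<in> R" for r v
    using that by (simp add: P_def inner_diff_right inner_sum_right dual if_distrib
        sum.delta[of R r "\<lambda>s. f s \<bullet> v"] cong: if_cong)
  have eP': "e r \<bullet> P' v = 0" if "r \<in> R" for r v
  proof -
    have "(\<Sum>s\<in>R. (e s \<bullet> v) * (e r \<bullet> f s)) = (\<Sum>s\<in>R. if s = r then e s \<bullet> v else 0)"
      using dual that by (intro sum.cong) (auto simp: inner_commute[of "e r"])
    then show ?thesis using that by (simp add: P'_def inner_diff_right inner_sum_right)
  qed
  have P'W: "P' v \<in> W" for v using eP' by (simp add: W_def)
  have WP: "x \<bullet> P v = x \<bullet> v" if "x \<in> W" for x v
    using that by (simp add: P_def W_def inner_diff_right inner_sum_right inner_commute[of x])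
  have UP': "x \<bullet> P' v = x \<bullet> v" if "\<And>r. r \<in> R \<Longrightarrow> f r \<bullet> x = 0" for x v
    using that by (simp add: P'_def inner_diff_right inner_sum_right inner_commute[of x])

  have "card R < CARD('n)" using R by (simp add: psubset_card_mono psubset_eq)
  then have "dim (span (e ` R)) < DIM(real^'n)"
    using dim_le_card'[of "e ` R"] card_image_le[of R e] by (simp add: dim_span)
  then obtain w0 where w0: "w0 \<noteq> 0" "\<And>y. y \<in> span (e ` R) \<Longrightarrow> orthogonal w0 y"
    using orthogonal_to_subspace_exists[of "e ` R"] by (auto simp: dim_span)
  have "w0 \<in> W" using w0(2) by (auto simp: W_def orthogonal_def inner_commute[of "e _"] span_base)
  then obtain j w1 where j: "j \<in> {1..L}" "W \<subseteq> flag X (j - 1)" and w1: "w1 \<in> W" "w1 \<notin> flag X j"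
    using flag_level_exists[OF X(2) _ w0(1)] by blast
  note Xj = fr_seqD[OF X(1) j(1)]
  have XjW: "psd_on W (X j)" using psd_on_mono[OF Xj(2) j(2)] .
  have w1X: "w1 \<bullet> (X j *v w1) \<noteq> 0" using flag_eqI[OF X(1) j(1)] w1 j(2) by blast
  \<comment> \<open>As a functional on \<open>W\<close>, \<open>g w\<close> agrees with
    \<open>X j *v w\<close>; the projection makes it orthogonal to the \<open>f r\<close>, as a new
    \<open>e\<close> has to be.\<close>
  define g where "g = (\<lambda>w. P (X j *v w))"
  have fg: "f r \<bullet> g w = 0" if "r \<in> R" for r w using fP[OF that] by (simp add: g_def)
  have "g w1 \<noteq> 0" using WP[OF w1(1), of "X j *v w1"] w1X by (auto simp: g_def)
  then obtain i u where i: "i \<in> {1..K}" "g ` W \<subseteq> flag A (i - 1)" and u: "u \<in> W" "g u \<notin> flag A i"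
    using flag_level_exists[OF A(2), of "g w1" "g ` W"] w1(1) by (metis imageE imageI)
  note Ai = fr_seqD[OF A(1) i(1)]
  define B where "B = matrix P ** X j"
  have B: "B *v w = g w" for w
    by (simp add: B_def g_def matrix_vector_mul_assoc[symmetric] matrix_works linP)
  define H where "H = transpose B ** A i ** B"
  have H: "v \<bullet> (H *v w) = g v \<bullet> (A i *v g w)" for v w
    by (simp add: H_def inner_congruence B)
  have "sym_mat H" unfolding H_def by (rule sym_mat_congruence[OF Ai(1)])
  moreover have "psd_on W H" using i(2) Ai(2) by (auto simp: psd_on_def H)
  moreover have "v \<bullet> (H *v v) = 0" if v: "v \<in> W" "v \<bullet> (X j *v v) = 0" for v
  proof -
    have "g v \<bullet> x = 0" for x
    proof -
      have "g v \<bullet> x = P' x \<bullet> g v" using UP'[of "g v" x] fg by (simp add: inner_commute)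
      also have "\<dots> = P' x \<bullet> (X j *v v)" using WP[OF P'W] by (simp add: g_def)
      also have "\<dots> = 0" using psd_on_null[OF W Xj(1) XjW v P'W] .
      finally show ?thesis .
    qed
    then show ?thesis by (simp add: H)
  qed
  moreover have "u \<bullet> (H *v u) \<noteq> 0"
  proof
    assume "u \<bullet> (H *v u) = 0"
    then have "g u \<in> flag A i" using flag_eqI[OF A(1) i(1)] i(2) u(1) by (auto simp: H)
    with u show False by simp
  qed
  ultimately obtain w \<mu> where w: "w \<in> W" "0 < \<mu>" "0 < w \<bullet> (X j *v w)"
    and eig: "\<And>v. v \<in> W \<Longrightarrow> v \<bullet> (H *v w) = \<mu> * (v \<bullet> (X j *v w))"
    using generalized_eigenvector[OF W Xj(1) XjW, of H u] u(1) by blast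
  define x where "x = g w"
  define y where "y = P' (A i *v x)"
  have x: "x \<in> flag A (i - 1)" "\<And>r. r \<in> R \<Longrightarrow> f r \<bullet> x = 0" using i(2) w(1) fg by (auto simp: x_def)
  have y: "y \<in> W" using P'W by (simp add: y_def)
  have yv: "y \<bullet> v = (A i *v x) \<bullet> P v" for v by (simp add: y_def adj)
  define c where "c = y \<bullet> x"
  have "P x = x" using x(2) by (simp add: P_def)
  then have "c = w \<bullet> (H *v w)" by (simp add: c_def yv H x_def inner_commute)
  then have c: "0 < c" using eig[OF w(1)] w by simp
  have yA: "y \<bullet> v = x \<bullet> (A i *v v)" if v: "v \<in> flag A (i - 1)" for v
  proof -
    have "(f r \<bullet> v) * (x \<bullet> (A i *v e r)) = 0" if "r \<in> R" for r
      using adapted_proj[of A i, OF Ai(1) _ _ _ x(1) x(2)[OF that] v] adA[OF that] i(1) by auto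
    then have "(\<Sum>r\<in>R. (f r \<bullet> v) * ((A i *v x) \<bullet> e r)) = 0"
      using sym_mat_inner[OF Ai(1), of x] by (intro sum.neutral) (simp add: inner_commute)
    then have "y \<bullet> v = (A i *v x) \<bullet> v"
      by (simp add: yv P_def inner_diff_right inner_sum_right)
    then show ?thesis using sym_mat_inner[OF Ai(1), of x v] by (simp add: inner_commute)
  qed
  \<comment> \<open>The eigenvalue equation turns the duality of \<open>y\<close> with
    \<open>x\<close> under \<open>A i\<close> into that of \<open>x\<close> with \<open>y\<close>
    under \<open>X j\<close>; this is what adapts one pair to both sequences.\<close>
  have xW: "x \<bullet> v = (1 / \<mu>) * (y \<bullet> (X j *v v))" if "v \<in> W" for v
  proof -
    have "y \<bullet> (X j *v v) = \<mu> * (v \<bullet> (X j *v w))"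
      using eig[OF that] by (simp add: yv H x_def g_def inner_commute)
    also have "v \<bullet> (X j *v w) = x \<bullet> v" using WP[OF that] by (simp add: x_def g_def inner_commute)
    finally show ?thesis using w by simp
  qed
  \<comment> \<open>From \<open>W\<close> to all of \<open>flag X (j - 1)\<close>: replacing
    \<open>v\<close> by \<open>P' v\<close> subtracts multiples of the \<open>f r\<close>, and by
    \<open>adapted_proj\<close> these contribute nothing to the product with \<open>y\<close> under
    \<open>X j\<close>.\<close>
  have xX: "x \<bullet> v = (1 / \<mu>) * (y \<bullet> (X j *v v))" if v: "v \<in> flag X (j - 1)" for v
  proof -
    have ey: "e r \<bullet> y = 0" if "r \<in> R" for r using y that by (simp add: W_def)
    have yj: "y \<in> flag X (j - 1)" using y j(2) by blast
    have "(e r \<bullet> v) * (y \<bullet> (X j *v f r)) = 0" if "r \<in> R" for r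
      using adapted_proj[of X j, OF Xj(1) _ _ _ yj ey[OF that] v] adX[OF that] j(1) by auto
    then have "(\<Sum>r\<in>R. (e r \<bullet> v) * ((X j *v y) \<bullet> f r)) = 0"
      using sym_mat_inner[OF Xj(1), of y] by (intro sum.neutral) (simp add: inner_commute)
    then have "(X j *v y) \<bullet> P' v = (X j *v y) \<bullet> v"
      by (simp add: P'_def inner_diff_right inner_sum_right)
    then have "y \<bullet> (X j *v P' v) = y \<bullet> (X j *v v)"
      using sym_mat_inner[OF Xj(1), of y] by (simp add: inner_commute)
    then show ?thesis using xW[OF P'W] UP'[of x v] x(2) by simp
  qed
  show thesis
  proof
    show "i \<in> {1..K}" "j \<in> {1..L}" by fact+
    show "adapted A i x ((1 / c) *\<^sub>R y)" unfolding adapted_def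
      using x(1) yA c by (intro conjI exI[of _ "1 / c"]) auto
    have "(1 / c) *\<^sub>R y \<in> flag X (j - 1)" using y j(2) by (intro subspace_scale subspace_flag) auto
    then show "adapted X j ((1 / c) *\<^sub>R y) x" unfolding adapted_def
      using xX c w by (intro conjI exI[of _ "c / \<mu>"]) (auto simp: field_simps)
    show "((1 / c) *\<^sub>R y) \<bullet> x = 1" using c by (simp add: c_def)
    show "f r \<bullet> x = 0 \<and> ((1 / c) *\<^sub>R y) \<bullet> e r = 0" if "r \<in> R" for r
      using x(2) y that by (simp add: W_def inner_commute)
  qed
qed

lemma adapted_dual_bases_partial:
  fixes A X :: "nat \<Rightarrow> real^'n^'n" and R :: "'n set"
  assumes A: "fr_seq K A" "flag A K = {0}" and X: "fr_seq L X" "flag X L = {0}"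
  shows "\<exists>(e :: 'n \<Rightarrow> real^'n) f a b.
    (\<forall>r\<in>R. \<forall>s\<in>R. f r \<bullet> e s = (if r = s then 1 else 0)) \<and>
    (\<forall>r\<in>R. a r \<in> {1..K} \<and> adapted A (a r) (e r) (f r)) \<and>
    (\<forall>r\<in>R. b r \<in> {1..L} \<and> adapted X (b r) (f r) (e r))"
  using finite[of R]
proof (induction R rule: finite_induct)
  case (insert q R)
  then obtain e f :: "'n \<Rightarrow> real^'n" and a b where
    dual: "\<forall>r\<in>R. \<forall>s\<in>R. f r \<bullet> e s = (if r = s then 1 else 0)" and
    adA: "\<forall>r\<in>R. a r \<in> {1..K} \<and> adapted A (a r) (e r) (f r)" and
    adX: "\<forall>r\<in>R. b r \<in> {1..L} \<and> adapted X (b r) (f r) (e r)" by blast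
  obtain i j x y where new: "i \<in> {1..K}" "j \<in> {1..L}" "adapted A i x y" "adapted X j y x" "y \<bullet> x = 1"
    "\<And>r. r \<in> R \<Longrightarrow> f r \<bullet> x = 0 \<and> y \<bullet> e r = 0"
    by (rule adapted_dual_extend[OF A X, of R f e a b]) (use insert.hyps dual adA adX in auto)
  show ?case
    by (rule exI[of _ "e(q := x)"], rule exI[of _ "f(q := y)"], rule exI[of _ "a(q := i)"],
        rule exI[of _ "b(q := j)"])
      (use insert.hyps dual adA adX new in auto)
qed simp

lemmas adapted_dual_bases = adapted_dual_bases_partial[where R = UNIV, simplified ball_UNIV]

section \<open>Algebra of the trace product\<close>

lemma mat_prod_sum: "A \<bullet>\<^sub>S X = (\<Sum>r\<in>UNIV. \<Sum>s\<in>UNIV. A $ r $ s * X $ s $ r)"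
  by (simp add: mat_prod_def trace_def matrix_matrix_mult_def)

lemma mat_prod_commute: "A \<bullet>\<^sub>S X = X \<bullet>\<^sub>S A"
  unfolding mat_prod_def by (rule trace_mul_sym)

lemma mat_prod_inner: "sym_mat A \<Longrightarrow> A \<bullet>\<^sub>S X = A \<bullet> X"
  unfolding mat_prod_sum inner_vec_def
  by (subst sum.swap) (auto intro!: sum.cong simp: sym_mat_entry[of A])

lemma mat_prod_add_right: "A \<bullet>\<^sub>S (X + Y) = A \<bullet>\<^sub>S X + A \<bullet>\<^sub>S Y"
  and mat_prod_scaleR_right: "A \<bullet>\<^sub>S (c *\<^sub>R X) = c * (A \<bullet>\<^sub>S X)"
  and mat_prod_add_left: "(A + B) \<bullet>\<^sub>S X = A \<bullet>\<^sub>S X + B \<bullet>\<^sub>S X"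
  and mat_prod_scaleR_left: "(c *\<^sub>R A) \<bullet>\<^sub>S X = c * (A \<bullet>\<^sub>S X)"
  and mat_prod_zero_left: "0 \<bullet>\<^sub>S X = 0"
  by (simp_all add: mat_prod_sum algebra_simps sum.distrib sum_distrib_left)

lemma mat_prod_sum_right: "A \<bullet>\<^sub>S (\<Sum>i\<in>I. f i) = (\<Sum>i\<in>I. A \<bullet>\<^sub>S f i)"
  by (induction I rule: infinite_finite_induct)
    (simp_all add: mat_prod_add_right mat_prod_commute[of A 0] mat_prod_zero_left)

text \<open>\<open>S\<close> is the inverse transpose of \<open>T\<close>, so the inner factors
  cancel, and the outer ones after a cyclic shift. Hence the base equations survive when the two
  sequences are expressed in dual bases.\<close>

lemma mat_prod_congruence:
  fixes S T :: "real^'n^'n"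
  assumes "transpose S ** T = mat 1"
  shows "(transpose T ** A ** T) \<bullet>\<^sub>S (transpose S ** X ** S) = A \<bullet>\<^sub>S X"
proof -
  have TS: "T ** transpose S = mat 1" using assms matrix_left_right_inverse by blast
  then have ST: "S ** transpose T = mat 1"
    by (metis matrix_transpose_mul transpose_mat transpose_transpose)
  have "(transpose T ** A ** T) \<bullet>\<^sub>S (transpose S ** X ** S)
      = trace (transpose T ** (A ** (T ** transpose S) ** X ** S))"
    by (simp add: mat_prod_def matrix_mul_assoc)
  also have "\<dots> = trace (A ** (T ** transpose S) ** X ** (S ** transpose T))"
    by (subst trace_mul_sym) (simp add: matrix_mul_assoc)
  finally show ?thesis by (simp add: TS ST mat_prod_def)
qed

section \<open>Echelon form\<close>

text \<open>The condition on one matrix is separated because a reset changes single matrices while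
  the structure stays fixed.\<close>

definition echelon_at :: "(nat \<Rightarrow> 'n set) \<Rightarrow> nat \<Rightarrow> real^'n^'n \<Rightarrow> bool" where
  "echelon_at P i M \<longleftrightarrow> sym_mat M \<and>
     (\<forall>r\<in>P i. \<forall>s\<in>P i. r \<noteq> s \<longrightarrow> M $ r $ s = 0) \<and> (\<forall>r\<in>P i. 0 < M $ r $ r) \<and>
     (\<forall>r s. r \<notin> (\<Union>j\<in>{1..<i}. P j) \<and> s \<notin> (\<Union>j\<in>{1..<i}. P j) \<and> \<not> (r \<in> P i \<and> s \<in> P i)
        \<longrightarrow> M $ r $ s = 0)"

lemma echelon_struct_iff:
  "echelon_struct k M P \<longleftrightarrow> disjoint_family_on P {1..k} \<and> (\<forall>i\<in>{1..k}. echelon_at P i (M i))"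
  unfolding echelon_struct_def echelon_at_def by (rule refl)

lemma echelon_structD:
  assumes "echelon_struct k M P" "i \<in> {1..k}"
  shows "echelon_at P i (M i)"
  using assms unfolding echelon_struct_iff by blast

lemma echelon_struct_disjoint:
  assumes "echelon_struct k M P" "i \<in> {1..k}" "j \<in> {1..k}" "i \<noteq> j"
  shows "P i \<inter> P j = {}"
  using assms unfolding echelon_struct_iff disjoint_family_on_def by blast

lemma echelon_struct_notin_below:
  assumes "echelon_struct k M P" "i \<in> {1..k}" "r \<in> P i"
  shows "r \<notin> (\<Union>j\<in>{1..<i}. P j)"
proof
  assume "r \<in> (\<Union>j\<in>{1..<i}. P j)"
  then obtain j where j: "1 \<le> j" "j < i" "r \<in> P j" by auto
  then have "j \<in> {1..k}" "j \<noteq> i" using assms(2) by auto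
  then show False using echelon_struct_disjoint[OF assms(1,2)] assms(3) j(3) by blast
qed

lemma echelon_atD:
  assumes "echelon_at P i M"
  shows "sym_mat M"
    and "r \<in> P i \<Longrightarrow> s \<in> P i \<Longrightarrow> r \<noteq> s \<Longrightarrow> M $ r $ s = 0"
    and "r \<in> P i \<Longrightarrow> 0 < M $ r $ r"
    and "r \<notin> (\<Union>j\<in>{1..<i}. P j) \<Longrightarrow> s \<notin> (\<Union>j\<in>{1..<i}. P j) \<Longrightarrow> \<not> (r \<in> P i \<and> s \<in> P i)
      \<Longrightarrow> M $ r $ s = 0"
  using assms unfolding echelon_at_def by blast+

lemma echelon_at_eq_0:
  assumes "echelon_at P i M" "r \<notin> (\<Union>j\<in>{1..<i}. P j)" "s \<notin> (\<Union>j\<in>{1..<i}. P j)" "r \<notin> P i \<or> r \<noteq> s"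
  shows "M $ r $ s = 0"
  using echelon_atD(2,4)[OF assms(1)] assms(2-4) by blast

text \<open>The rows and, by symmetry, the columns in which \<open>M\<close> is arbitrary meet zeros
  of \<open>Y\<close>; what is left of \<open>M\<close> is a positive diagonal on
  \<open>P i\<close>. The sign of the product can then be read off the diagonal of
  \<open>Y\<close>.\<close>

lemma echelon_mat_prod:
  assumes M: "echelon_at P i M" and Y: "sym_mat Y"
    and van: "\<And>r s. r \<in> (\<Union>j\<in>{1..<i}. P j) \<Longrightarrow> Y $ r $ s = 0"
  shows "M \<bullet>\<^sub>S Y = (\<Sum>r\<in>P i. M $ r $ r * Y $ r $ r)"
proof -
  have "M $ r $ s * Y $ s $ r = (if s = r then if r \<in> P i then M $ r $ r * Y $ r $ r else 0 else 0)"
    for r s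
  proof (cases "r \<in> (\<Union>j\<in>{1..<i}. P j) \<or> s \<in> (\<Union>j\<in>{1..<i}. P j)")
    case True
    then have "Y $ s $ r = 0" using van sym_mat_entry[OF Y, of s r] by metis
    then show ?thesis by (cases "s = r") simp_all
  next
    case False
    then show ?thesis using echelon_at_eq_0[OF M, of r s] by auto
  qed
  then have "M \<bullet>\<^sub>S Y = (\<Sum>r\<in>UNIV. if r \<in> P i then M $ r $ r * Y $ r $ r else 0)"
    by (simp add: mat_prod_sum)
  then show ?thesis by (simp flip: sum.inter_filter)
qed

text \<open>As long as \<open>P\<^sub>1\<close> avoids \<open>Q\<^sub>1, \<dots>, Q\<^sub>j\<^sub>-\<^sub>1\<close>, the product \<open>A\<^sub>1 \<bullet> X\<^sub>j\<close> is a sum of nonnegative terms over \<open>P\<^sub>1\<close>,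
  and the terms in \<open>P\<^sub>1 \<inter> Q\<^sub>j\<close> are positive.\<close>

lemma echelon_first_disjoint:
  assumes A: "echelon_struct K A P" "1 \<le> K" and X: "echelon_struct L X Q"
    and eq: "\<And>j. j \<in> {1..l} \<Longrightarrow> A 1 \<bullet>\<^sub>S X j = 0" and "l \<le> L"
  shows "j \<in> {1..l} \<Longrightarrow> P 1 \<inter> Q j = {}"
    and "l < L \<Longrightarrow> 0 \<le> A 1 \<bullet>\<^sub>S X (l + 1)"
proof -
  have A1: "echelon_at P 1 (A 1)" using A by (intro echelon_structD[OF A(1)]) auto
  have prod: "A 1 \<bullet>\<^sub>S X j = (\<Sum>r\<in>P 1. A 1 $ r $ r * X j $ r $ r)" if "j \<in> {1..L}" for j
    by (rule echelon_mat_prod[OF A1 echelon_atD(1)[OF echelon_structD[OF X that]]]) simp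
  have nonneg: "0 \<le> A 1 $ r $ r * X j $ r $ r"
    if "j \<in> {1..L}" "\<And>h. h \<in> {1..<j} \<Longrightarrow> P 1 \<inter> Q h = {}" "r \<in> P 1" for j r
  proof -
    have "0 \<le> X j $ r $ r"
    proof (cases "r \<in> Q j")
      case False
      have "r \<notin> (\<Union>h\<in>{1..<j}. Q h)" using that(2,3) by blast
      then show ?thesis using echelon_at_eq_0[OF echelon_structD[OF X that(1)], of r r] False by simp
    qed (use echelon_atD(3)[OF echelon_structD[OF X that(1)]] in force)
    then show ?thesis using echelon_atD(3)[OF A1 that(3)] by simp
  qed
  have disj: "j \<in> {1..l} \<longrightarrow> P 1 \<inter> Q j = {}" for j
  proof (induction j rule: less_induct)
    case (less j)
    show ?case
    proof (intro impI equals0I)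
      fix r assume j: "j \<in> {1..l}" and r: "r \<in> P 1 \<inter> Q j"
      have jL: "j \<in> {1..L}" using j \<open>l \<le> L\<close> by simp
      have IH: "P 1 \<inter> Q h = {}" if "h \<in> {1..<j}" for h using less.IH[of h] that j by auto
      have "0 < A 1 $ r $ r * X j $ r $ r"
        using r echelon_atD(3)[OF A1] echelon_atD(3)[OF echelon_structD[OF X jL]] by simp
      then have "0 < (\<Sum>r\<in>P 1. A 1 $ r $ r * X j $ r $ r)"
        using r nonneg[OF jL IH] by (intro sum_pos2[of _ r]) auto
      then show False using prod[OF jL] eq[OF j] by simp
    qed
  qed
  then show "j \<in> {1..l} \<Longrightarrow> P 1 \<inter> Q j = {}" by blast
  show "0 \<le> A 1 \<bullet>\<^sub>S X (l + 1)" if "l < L"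
  proof -
    have L: "l + 1 \<in> {1..L}" using that by simp
    have "P 1 \<inter> Q h = {}" if "h \<in> {1..<l + 1}" for h using disj[of h] that by auto
    then show ?thesis unfolding prod[OF L] using nonneg[OF L] by (intro sum_nonneg) blast
  qed
qed

definition colmat :: "('n \<Rightarrow> real^'n) \<Rightarrow> real^'n^'n" where
  "colmat e = (\<chi> s r. e r $ s)"

lemma colmat_axis: "colmat e *v axis r 1 = e r"
  by (simp add: matrix_vector_mult_basis column_def colmat_def)

lemma colmat_congruence_entry:
  fixes M :: "real^'n^'n"
  shows "(transpose (colmat e) ** M ** colmat e) $ r $ s = e r \<bullet> (M *v e s)"
proof -
  have "N $ r $ s = axis r 1 \<bullet> (N *v axis s 1)" for N :: "real^'n^'n"
    by (simp add: inner_axis' matrix_vector_mult_basis column_def)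
  then show ?thesis by (simp only: inner_congruence colmat_axis)
qed

lemma colmat_dual:
  fixes e f :: "'n::finite \<Rightarrow> real^'n"
  assumes "\<And>r s. f r \<bullet> e s = (if r = s then 1 else 0)"
  shows "transpose (colmat f) ** colmat e = mat 1"
proof -
  have "(transpose (colmat f) ** colmat e) $ r $ s = f r \<bullet> e s" for r s
    by (simp add: matrix_matrix_mult_def transpose_def colmat_def inner_vec_def)
  then show ?thesis by (simp add: vec_eq_iff mat_def assms)
qed

lemma colmat_expansion:
  fixes e f :: "'n::finite \<Rightarrow> real^'n"
  assumes "\<And>r s. f r \<bullet> e s = (if r = s then 1 else 0)"
  shows "v = (\<Sum>r\<in>UNIV. (f r \<bullet> v) *\<^sub>R e r)"
proof -
  have "colmat e ** transpose (colmat f) = mat 1"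
    using colmat_dual[of f e] assms matrix_left_right_inverse by blast
  then have "v = colmat e *v (transpose (colmat f) *v v)"
    by (simp only: matrix_vector_mul_assoc matrix_vector_mul_lid)
  also have "\<dots> = (\<Sum>r\<in>UNIV. (f r \<bullet> v) *\<^sub>R e r)"
    by (simp add: vec_eq_iff matrix_vector_mult_def transpose_def colmat_def inner_vec_def mult.commute)
  finally show ?thesis .
qed

text \<open>The levels serve as the structure: rows and columns outside the earlier blocks have
  level at least \<open>i\<close>. There, off-diagonal entries vanish by
  \<open>adapted_orth\<close>; a diagonal entry of higher level vanishes since \<open>e r\<close>
  lies in the radical \<open>flag M i\<close>; at level \<open>i\<close>,
  \<open>f r \<bullet> e r = 1\<close> is a positive multiple of the diagonal entry.\<close>

lemma echelon_of_adapted: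
  assumes M: "\<And>i. i \<in> {1..K} \<Longrightarrow> sym_mat (M i)"
    and ad: "\<And>r. 1 \<le> a r \<and> adapted M (a r) (e r) (f r)"
    and dual: "\<And>r s. f r \<bullet> e s = (if r = s then 1 else 0)"
  shows "echelon_struct K (\<lambda>i. transpose (colmat e) ** M i ** colmat e) (\<lambda>i. {r. a r = i})"
  unfolding echelon_struct_iff
proof (intro conjI ballI)
  show "disjoint_family_on (\<lambda>i. {r. a r = i}) {1..K}" by (auto simp: disjoint_family_on_def)
  fix i assume i: "i \<in> {1..K}"
  have below: "i \<le> a r" if "r \<notin> (\<Union>j\<in>{1..<i}. {r. a r = j})" for r
    using that ad[of r] by (auto simp: not_less)
  have zero: "e r \<bullet> (M i *v e s) = 0" if "i \<le> a r" "i \<le> a s" "r \<noteq> s" for r s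
  proof -
    have "e r \<in> flag M (a r - 1)" using ad[of r] by (simp add: adapted_def)
    moreover have "i - 1 \<le> a r - 1" using that(1) by (rule diff_le_mono)
    ultimately have "e r \<in> flag M (i - 1)" using flag_antimono by blast
    moreover have "f s \<bullet> e r = 0" using that(3) by (simp add: dual)
    ultimately show ?thesis
      using adapted_orth[of M i "a s" "e s" "f s" "e r"] M[OF i] ad[of s] i that(2) by simp
  qed
  have zero': "e r \<bullet> (M i *v e r) = 0" if "i < a r" for r
  proof -
    have er: "e r \<in> flag M (a r - 1)" using ad[of r] by (simp add: adapted_def)
    moreover have "i \<le> a r - 1" "i - 1 \<le> a r - 1" using that by linarith+
    ultimately have "e r \<in> flag M i" "e r \<in> flag M (i - 1)" using flag_antimono by blast+
    then show ?thesis using flag_orth[of i "e r" M] i by simp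
  qed
  have pos: "0 < e r \<bullet> (M (a r) *v e r)" for r
  proof -
    obtain c where "c > 0" "f r \<bullet> e r = c * (e r \<bullet> (M (a r) *v e r))"
      using ad[of r] by (auto simp: adapted_def)
    then show ?thesis by (simp add: dual) (metis zero_less_mult_pos zero_less_one)
  qed
  show "echelon_at (\<lambda>i. {r. a r = i}) i (transpose (colmat e) ** M i ** colmat e)"
    unfolding echelon_at_def colmat_congruence_entry
  proof (intro conjI allI ballI impI)
    show "sym_mat (transpose (colmat e) ** M i ** colmat e)"
      using M[OF i] by (rule sym_mat_congruence)
    show "e r \<bullet> (M i *v e s) = 0" if "r \<in> {r. a r = i}" "s \<in> {r. a r = i}" "r \<noteq> s" for r s
      using that by (intro zero) auto
    show "0 < e r \<bullet> (M i *v e r)" if "r \<in> {r. a r = i}" for r using pos[of r] that by simp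
    show "e r \<bullet> (M i *v e s) = 0"
      if "r \<notin> (\<Union>j\<in>{1..<i}. {r. a r = j}) \<and> s \<notin> (\<Union>j\<in>{1..<i}. {r. a r = j}) \<and>
        \<not> (r \<in> {r. a r = i} \<and> s \<in> {r. a r = i})" for r s
      using that below[of r] below[of s] zero[of r s] zero'[of r] by (cases "r = s") auto
  qed
qed

text \<open>Expand a vector of \<open>flag M (i - 1)\<close> in the basis: coefficients of level
  below \<open>i\<close> vanish, and basis vectors of level above \<open>i\<close> lie in
  \<open>flag M i\<close>. Without a vector of level \<open>i\<close> the flag would not
  descend.\<close>

lemma adapted_level_nonempty:
  fixes e f :: "'n::finite \<Rightarrow> real^'n"
  assumes ad: "\<And>r. 1 \<le> a r \<and> adapted M (a r) (e r) (f r)"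
    and dual: "\<And>r s. f r \<bullet> e s = (if r = s then 1 else 0)"
    and "flag M i \<noteq> flag M (i - 1)"
  shows "{r. a r = i} \<noteq> {}"
proof
  assume empty: "{r. a r = i} = {}"
  have "v \<in> flag M i" if v: "v \<in> flag M (i - 1)" for v
  proof -
    have "(f r \<bullet> v) *\<^sub>R e r \<in> flag M i" for r
    proof (cases "a r < i")
      case True
      then have "a r \<le> i - 1" by linarith
      then have "v \<in> flag M (a r)" using v flag_antimono by blast
      then have "f r \<bullet> v = 0" using adapted_vanish ad by blast
      then show ?thesis by (simp add: subspace_0 subspace_flag)
    next
      case False
      moreover have "a r \<noteq> i" using empty by blast
      ultimately have "i \<le> a r - 1" by linarith
      then have "e r \<in> flag M i" using flag_antimono[of i "a r - 1" M] ad[of r]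
        unfolding adapted_def by blast
      then show ?thesis by (simp add: subspace_scale subspace_flag)
    qed
    then have "(\<Sum>r\<in>UNIV. (f r \<bullet> v) *\<^sub>R e r) \<in> flag M i" by (intro subspace_sum subspace_flag)
    then show ?thesis using colmat_expansion[of f e v] dual by simp
  qed
  moreover have "flag M i \<subseteq> flag M (i - 1)" by (intro flag_antimono) simp
  ultimately show False using assms(3) by blast
qed

section \<open>Facial reduction sequences and simultaneous echelon form\<close>

lemma fr_seq_extend:
  assumes M: "fr_seq k M" and Y: "sym_mat Y" "psd_on (flag M k) Y"
  defines "M' \<equiv> M(k + 1 := Y)"
  shows "fr_seq (k + 1) M'" "\<And>i. i \<le> k \<Longrightarrow> flag M' i = flag M i"
proof -
  show flag: "flag M' i = flag M i" if "i \<le> k" for i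
    using that by (intro flag_cong) (auto simp: M'_def)
  show "fr_seq (k + 1) M'" unfolding fr_seq_def
  proof
    fix i assume i: "i \<in> {1..k + 1}"
    show "sym_mat (M' i) \<and> psd_on (flag M' (i - 1)) (M' i)"
    proof (cases "i = k + 1")
      case True
      then show ?thesis using Y flag[of k] by (simp add: M'_def)
    next
      case False
      then have "i \<in> {1..k}" using i by simp
      moreover have "i - 1 \<le> k" using i by auto
      ultimately show ?thesis using fr_seqD[OF assms(1)] flag False by (simp add: M'_def)
    qed
  qed
qed

text \<open>The identity is definite, so it ends the flag in \<open>{0}\<close>, as the construction
  of full bases requires. Its own level is discarded again once the echelon form is
  obtained.\<close>

lemma fr_seq_complete:
  assumes "fr_seq k M"
  defines "M' \<equiv> M(k + 1 := mat 1)"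
  shows "fr_seq (k + 1) M'" "flag M' (k + 1) = {0}" "\<And>i. i \<le> k \<Longrightarrow> flag M' i = flag M i"
proof -
  have "psd_on (flag M k) (mat 1)" by (simp add: psd_on_def)
  note ext = fr_seq_extend[OF assms(1) sym_mat_1 this, folded M'_def]
  show "fr_seq (k + 1) M'" by (rule ext(1))
  show "flag M' i = flag M i" if "i \<le> k" for i using that by (rule ext(2))
  have "v = 0" if "v \<in> flag M' (k + 1)" for v
  proof -
    have "v \<in> flag M' k" using that flag_antimono[of k "k + 1" M'] by auto
    then have "v \<bullet> (M' (k + 1) *v v) = 0" using flag_orth[of "k + 1" v M' v] that by simp
    then show ?thesis by (simp add: M'_def)
  qed
  then show "flag M' (k + 1) = {0}" using subspace_0[OF subspace_flag] by blast
qed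

lemma echelon_struct_cong:
  assumes "\<And>i. i \<in> {1..k} \<Longrightarrow> M i = M' i"
  shows "echelon_struct k M P \<longleftrightarrow> echelon_struct k M' P"
  using assms by (simp add: echelon_struct_iff)

lemma echelon_struct_mono: "echelon_struct k M P \<Longrightarrow> l \<le> k \<Longrightarrow> echelon_struct l M P"
  unfolding echelon_struct_iff disjoint_family_on_def by auto

lemma simultaneous_echelon:
  fixes A X :: "nat \<Rightarrow> real^'n^'n"
  assumes A: "fr_seq k A" and X: "fr_seq l X"
  obtains T S :: "real^'n^'n" and P Q where
    "transpose S ** T = mat 1"
    "echelon_struct k (\<lambda>i. transpose T ** A i ** T) P"
    "echelon_struct l (\<lambda>j. transpose S ** X j ** S) Q"
    "\<And>i. i \<in> {1..k} \<Longrightarrow> flag A i \<noteq> flag A (i - 1) \<Longrightarrow> P i \<noteq> {}"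
    "\<And>j. j \<in> {1..l} \<Longrightarrow> flag X j \<noteq> flag X (j - 1) \<Longrightarrow> Q j \<noteq> {}"
proof -
  define A' where "A' = A(k + 1 := mat 1)"
  define X' where "X' = X(l + 1 := mat 1)"
  note A' = fr_seq_complete[OF A, folded A'_def]
  note X' = fr_seq_complete[OF X, folded X'_def]
  obtain e f :: "'n \<Rightarrow> real^'n" and a b where
    dual: "\<And>r s. f r \<bullet> e s = (if r = s then 1 else 0)" and
    adA: "\<And>r. a r \<in> {1..k + 1} \<and> adapted A' (a r) (e r) (f r)" and
    adX: "\<And>r. b r \<in> {1..l + 1} \<and> adapted X' (b r) (f r) (e r)"
    using adapted_dual_bases[OF A'(1,2) X'(1,2)] by metis
  have dual': "e r \<bullet> f s = (if r = s then 1 else 0)" for r s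
    using dual[of s r] by (auto simp: inner_commute)
  have adA': "1 \<le> a r \<and> adapted A' (a r) (e r) (f r)" for r using adA[of r] by simp
  have adX': "1 \<le> b r \<and> adapted X' (b r) (f r) (e r)" for r using adX[of r] by simp
  show thesis
  proof (rule that[of "colmat f" "colmat e" "\<lambda>i. {r. a r = i}" "\<lambda>j. {r. b r = j}"])
    show "transpose (colmat f) ** colmat e = mat 1" using dual by (rule colmat_dual)
    have "echelon_struct (k + 1) (\<lambda>i. transpose (colmat e) ** A' i ** colmat e) (\<lambda>i. {r. a r = i})"
      by (rule echelon_of_adapted[OF fr_seqD(1)[OF A'(1)] adA' dual])
    then have "echelon_struct k (\<lambda>i. transpose (colmat e) ** A' i ** colmat e) (\<lambda>i. {r. a r = i})"
      by (rule echelon_struct_mono) simp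
    then show "echelon_struct k (\<lambda>i. transpose (colmat e) ** A i ** colmat e) (\<lambda>i. {r. a r = i})"
      by (subst echelon_struct_cong[where M' = "\<lambda>i. transpose (colmat e) ** A' i ** colmat e"])
        (auto simp: A'_def)
    have "echelon_struct (l + 1) (\<lambda>i. transpose (colmat f) ** X' i ** colmat f) (\<lambda>i. {r. b r = i})"
      by (rule echelon_of_adapted[OF fr_seqD(1)[OF X'(1)] adX' dual'])
    then have "echelon_struct l (\<lambda>i. transpose (colmat f) ** X' i ** colmat f) (\<lambda>i. {r. b r = i})"
      by (rule echelon_struct_mono) simp
    then show "echelon_struct l (\<lambda>i. transpose (colmat f) ** X i ** colmat f) (\<lambda>i. {r. b r = i})"
      by (subst echelon_struct_cong[where M' = "\<lambda>i. transpose (colmat f) ** X' i ** colmat f"])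
        (auto simp: X'_def)
    show "{r. a r = i} \<noteq> {}" if "i \<in> {1..k}" "flag A i \<noteq> flag A (i - 1)" for i
    proof (rule adapted_level_nonempty[OF adA' dual])
      have "i \<le> k" "i - 1 \<le> k" using that(1) by auto
      then show "flag A' i \<noteq> flag A' (i - 1)" using that(2) by (simp only: A'(3) not_False_eq_True)
    qed
    show "{r. b r = j} \<noteq> {}" if "j \<in> {1..l}" "flag X j \<noteq> flag X (j - 1)" for j
    proof (rule adapted_level_nonempty[OF adX' dual'])
      have "j \<le> l" "j - 1 \<le> l" using that(1) by auto
      then show "flag X' j \<noteq> flag X' (j - 1)" using that(2) by (simp only: X'(3) not_False_eq_True)
    qed
  qed
qed

section \<open>Correctness of the Base Equations Algorithm\<close>

lemma bea_init_exists:
  assumes "1 \<le> k" "k < CARD('n::finite)" "1 \<le> l" "l < CARD('n)"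
  shows "\<exists>(P :: nat \<Rightarrow> 'n set) Q A X. bea_init k l P Q A X"
proof -
  define n where "n = CARD('n)"
  obtain g where g: "bij_betw g {1..n} (UNIV :: 'n set)"
    using ex_bij_betw_nat_finite_1[OF finite[of "UNIV :: 'n set"]] by (auto simp: n_def)
  then have inj: "inj_on g {1..n}" by (rule bij_betw_imp_inj_on)
  \<comment> \<open>\<open>Q 1\<close> gets the last index, which \<open>k < n\<close> keeps out of
    all \<open>P i\<close> and \<open>l < n\<close> out of the other \<open>Q j\<close>. The other
    nonempty \<open>Q j\<close> start at index 2 and so avoid \<open>P 1\<close>;
    \<open>P (k + 1)\<close> and \<open>Q (l + 1)\<close> are empty.\<close>
  define P where "P = (\<lambda>i. if 1 \<le> i \<and> i \<le> k then {g i} else {})"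
  define Q where "Q = (\<lambda>j. if j = 1 then {g n} else if 2 \<le> j \<and> j \<le> l then {g j} else {})"
  define D where "D = (\<lambda>(P :: nat \<Rightarrow> 'n set) i. (\<chi> r s. if r = s \<and> r \<in> P i then 1 else 0) :: real^'n^'n)"
  have D: "echelon_struct K (D P) P" if "disjoint_family_on P {1..K}" for K P
    using that by (auto simp: echelon_struct_iff echelon_at_def D_def sym_mat_iff)
  have kn: "k < n" "l < n" using assms by (auto simp: n_def)
  have gi: "g i = g j \<longleftrightarrow> i = j" if "i \<in> {1..n}" "j \<in> {1..n}" for i j
    using inj that by (rule inj_on_eq_iff)
  have "disjoint_family_on P {1..k + 1}" using kn gi assms
    by (auto simp: disjoint_family_on_def P_def)
  moreover have "disjoint_family_on Q {1..l + 1}" using kn gi assms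
    by (auto simp: disjoint_family_on_def Q_def)
  moreover have "P 1 \<inter> (\<Union>j\<in>{1..l + 1}. Q j) = {}" "Q 1 \<inter> (\<Union>i\<in>{1..k + 1}. P i) = {}"
    using kn assms by (auto simp: P_def Q_def gi split: if_splits)
  ultimately have "bea_init k l P Q (D P) (D Q)"
    unfolding bea_init_def using D by (auto simp: P_def Q_def)
  then show ?thesis by blast
qed

lemma reset_block_commute: "reset_block R S M M' \<longleftrightarrow> reset_block S R M M'"
  unfolding reset_block_def by blast

text \<open>The rows \<open>R\<close> belong to earlier blocks, where an echelon form is
  unconstrained. For the reset \<open>A i\<close> these are the rows \<open>P (i - 1)\<close>, for
  the \<open>X j\<close> with \<open>j \<ge> 2\<close> the rows \<open>Q 1\<close>.\<close>

lemma echelon_at_reset: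
  assumes M: "echelon_at P i M" and re: "reset_block R S M M'"
    and R: "R \<subseteq> (\<Union>j\<in>{1..<i}. P j)" "R \<inter> P i = {}"
  shows "echelon_at P i M'"
proof -
  have sym: "sym_mat M'" using re by (simp add: reset_block_def)
  have eq: "M' $ r $ s = M $ r $ s" if "r \<notin> R" "s \<notin> R" for r s
    using re that unfolding reset_block_def by blast
  have "r \<notin> R" if "r \<in> P i \<or> r \<notin> (\<Union>j\<in>{1..<i}. P j)" for r using that R by blast
  then show ?thesis using M sym eq unfolding echelon_at_def by simp
qed

lemma mat_prod_cong:
  assumes "\<And>r s. A $ r $ s = 0 \<or> X $ s $ r = X' $ s $ r"
  shows "A \<bullet>\<^sub>S X = A \<bullet>\<^sub>S X'"
proof -
  have "A $ r $ s * X $ s $ r = A $ r $ s * X' $ s $ r" for r s using assms[of r s] by auto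
  then show ?thesis unfolding mat_prod_sum by (intro sum.cong refl)
qed

definition bea_inv :: "nat \<Rightarrow> nat \<Rightarrow> (nat \<Rightarrow> 'n::finite set) \<Rightarrow> (nat \<Rightarrow> 'n set) \<Rightarrow> nat \<Rightarrow>
    (nat \<Rightarrow> real^'n^'n) \<Rightarrow> (nat \<Rightarrow> real^'n^'n) \<Rightarrow> bool" where
  "bea_inv k l P Q t A X \<longleftrightarrow> bea_init k l P Q A X \<and> 1 \<le> t \<and>
     (\<forall>i\<in>{1..t}. \<forall>j\<in>{1..l + 1}. base_eq k l A X i j)"

lemma bea_initD:
  assumes "bea_init k l P Q A X"
  shows "echelon_struct (k + 1) A P" "echelon_struct (l + 1) X Q"
    "\<And>i. i \<in> {1..k} \<Longrightarrow> P i \<noteq> {}" "\<And>j. j \<in> {1..l} \<Longrightarrow> Q j \<noteq> {}"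
    "\<And>j. j \<in> {1..l + 1} \<Longrightarrow> P 1 \<inter> Q j = {}" "\<And>i. i \<in> {1..k + 1} \<Longrightarrow> Q 1 \<inter> P i = {}"
  using assms unfolding bea_init_def by blast+

text \<open>The loop never treats row 1. It holds from the start because \<open>A 1\<close> is
  diagonal and supported on \<open>P 1\<close>, where every \<open>X j\<close> has zero
  diagonal.\<close>

lemma bea_init_base_eq:
  assumes "bea_init k l P Q A X" "1 \<le> k" "j \<in> {1..l + 1}"
  shows "base_eq k l A X 1 j"
proof -
  note I = bea_initD[OF assms(1)]
  have A1: "echelon_at P 1 (A 1)" using echelon_structD[OF I(1)] by simp
  note Xj = echelon_structD[OF I(2) assms(3)]
  have "A 1 \<bullet>\<^sub>S X j = (\<Sum>r\<in>P 1. A 1 $ r $ r * X j $ r $ r)"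
    by (rule echelon_mat_prod[OF A1 echelon_atD(1)[OF Xj]]) simp
  also have "\<dots> = 0"
  proof (rule sum.neutral, rule ballI)
    fix r assume r: "r \<in> P 1"
    have Q: "r \<notin> Q h" if "h \<in> {1..l + 1}" for h using I(5)[OF that] r by blast
    then have "X j $ r $ r = 0" using assms(3) by (intro echelon_at_eq_0[OF Xj]) auto
    then show "A 1 $ r $ r * X j $ r $ r = 0" by simp
  qed
  finally show ?thesis using assms(2) by (simp add: base_eq_def)
qed

lemma bea_iter_inv:
  assumes inv: "bea_inv k l P Q t A X" and t: "t + 1 \<le> k + 1" and l: "1 \<le> l"
    and it: "bea_iter k l P Q (t + 1) A X A' X'"
  shows "bea_inv k l P Q (t + 1) A' X'"
proof -
  have init: "bea_init k l P Q A X" and t1: "1 \<le> t"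
    and base: "\<And>i j. i \<in> {1..t} \<Longrightarrow> j \<in> {1..l + 1} \<Longrightarrow> base_eq k l A X i j"
    using inv by (auto simp: bea_inv_def)
  note I = bea_initD[OF init]
  have reA: "reset_block (P t) (Q 1) (A (t + 1)) (A' (t + 1))"
    and A': "\<And>h. h \<noteq> t + 1 \<Longrightarrow> A' h = A h"
    and reX: "\<And>j. j \<in> {2..l + 1} \<Longrightarrow> reset_block (P t) (Q 1) (X j) (X' j)"
    and X': "\<And>j. j \<notin> {2..l + 1} \<Longrightarrow> X' j = X j"
    and new: "\<And>j. j \<in> {2..l + 1} \<Longrightarrow> base_eq k l A' X' (t + 1) j"
    using it by (auto simp: bea_iter_def)
  have tk: "t \<in> {1..k + 1}" "t + 1 \<in> {1..k + 1}" using t t1 by auto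
  have A'e: "echelon_struct (k + 1) A' P"
    unfolding echelon_struct_iff
  proof (intro conjI ballI)
    show "disjoint_family_on P {1..k + 1}" using I(1) by (simp add: echelon_struct_iff)
    fix i assume i: "i \<in> {1..k + 1}"
    show "echelon_at P i (A' i)"
    proof (cases "i = t + 1")
      case True
      have "P t \<inter> P (t + 1) = {}" using echelon_struct_disjoint[OF I(1) tk] by simp
      moreover have "P t \<subseteq> (\<Union>j\<in>{1..<t + 1}. P j)" using t1 by auto
      ultimately show ?thesis
        using echelon_at_reset[OF echelon_structD[OF I(1) tk(2)] reA] True by simp
    qed (use A' echelon_structD[OF I(1) i] in simp)
  qed
  have X'e: "echelon_struct (l + 1) X' Q"
    unfolding echelon_struct_iff
  proof (intro conjI ballI)
    show "disjoint_family_on Q {1..l + 1}" using I(2) by (simp add: echelon_struct_iff)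
    fix j assume j: "j \<in> {1..l + 1}"
    show "echelon_at Q j (X' j)"
    proof (cases "j = 1")
      case False
      then have j2: "j \<in> {2..l + 1}" using j by auto
      have "Q 1 \<inter> Q j = {}" using echelon_struct_disjoint[OF I(2) _ j] False by auto
      moreover have "Q 1 \<subseteq> (\<Union>h\<in>{1..<j}. Q h)" using j2 by (intro UN_upper) auto
      ultimately show ?thesis
        using echelon_at_reset[OF echelon_structD[OF I(2) j]] reX[OF j2] reset_block_commute by blast
    qed (use X' echelon_structD[OF I(2) j] in auto)
  qed
  have init': "bea_init k l P Q A' X'" using init A'e X'e by (simp add: bea_init_def)
  have "base_eq k l A' X' i j" if i: "i \<in> {1..t + 1}" and j: "j \<in> {1..l + 1}" for i j
  proof (cases "i = t + 1")
    case True
    show ?thesis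
    proof (cases "j = 1")
      case True
      \<comment> \<open>Column 1 is not prescribed by the iteration: it holds because
        \<open>X' 1\<close> is diagonal and supported on \<open>Q 1\<close>, where
        \<open>A' (t + 1)\<close> has zero diagonal.\<close>
      have X1: "echelon_at Q 1 (X' 1)" using echelon_structD[OF X'e] by simp
      have Ai: "echelon_at P (t + 1) (A' (t + 1))" using echelon_structD[OF A'e tk(2)] .
      have "X' 1 \<bullet>\<^sub>S A' (t + 1) = (\<Sum>r\<in>Q 1. X' 1 $ r $ r * A' (t + 1) $ r $ r)"
        by (rule echelon_mat_prod[OF X1 echelon_atD(1)[OF Ai]]) simp
      also have "\<dots> = 0"
      proof (rule sum.neutral, rule ballI)
        fix r assume r: "r \<in> Q 1"
        have "r \<notin> P h" if "h \<in> {1..k + 1}" for h using I(6)[OF that] r by blast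
        then have "A' (t + 1) $ r $ r = 0" using tk t by (intro echelon_at_eq_0[OF Ai]) auto
        then show "X' 1 $ r $ r * A' (t + 1) $ r $ r = 0" by simp
      qed
      finally show ?thesis using \<open>i = t + 1\<close> True l by (simp add: base_eq_def mat_prod_commute)
    next
      case False
      then show ?thesis using new[of j] j \<open>i = t + 1\<close> by auto
    qed
  next
    case False
    then have it: "i \<in> {1..t}" and ik: "i \<in> {1..k + 1}" using i t by auto
    note Ai = echelon_structD[OF I(1) ik]
    have "A i \<bullet>\<^sub>S X' j = A i \<bullet>\<^sub>S X j"
    proof (cases "j \<in> {2..l + 1}")
      case True
      \<comment> \<open>Earlier rows survive: the reset entries of \<open>X j\<close> face entries
        of \<open>A i\<close> with one index in \<open>P t\<close>, where \<open>t \<ge> i\<close>,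
        and the other in \<open>Q 1\<close>. These lie outside the arbitrary rows and the diagonal
        block of \<open>A i\<close>.\<close>
      have zero: "A i $ r $ s = 0" if "r \<in> P t" "s \<in> Q 1" for r s
      proof (rule echelon_at_eq_0[OF Ai])
        have sP: "s \<notin> P h" if "h \<in> {1..k + 1}" for h using I(6)[OF that] \<open>s \<in> Q 1\<close> by blast
        then show "s \<notin> (\<Union>h\<in>{1..<i}. P h)" using ik by auto
        show "r \<notin> P i \<or> r \<noteq> s" using sP[OF ik] by blast
        have "r \<notin> (\<Union>h\<in>{1..<t}. P h)" using echelon_struct_notin_below[OF I(1) tk(1) that(1)] .
        then show "r \<notin> (\<Union>h\<in>{1..<i}. P h)" using it by auto
      qed
      have "A i $ r $ s = 0 \<or> X' j $ s $ r = X j $ s $ r" for r s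
        using zero[of r s] zero[of s r] sym_mat_entry[OF echelon_atD(1)[OF Ai], of r s] reX[OF True]
        unfolding reset_block_def by metis
      then show ?thesis by (rule mat_prod_cong)
    qed (simp add: X')
    then show ?thesis using base[OF it j] A'[OF False] by (simp add: base_eq_def)
  qed
  then show ?thesis using init' t1 by (simp add: bea_inv_def)
qed

lemma bea_run_inv:
  assumes "bea_run k l P Q t A X" "1 \<le> k" "1 \<le> l"
  shows "bea_inv k l P Q t A X"
  using assms
proof (induction rule: bea_run.induct)
  case (init A X)
  then have "base_eq k l A X 1 j" if "j \<in> {1..l + 1}" for j using bea_init_base_eq that by blast
  then show ?case using init.hyps unfolding bea_inv_def by simp
next
  case (iter t A X A' X')
  then show ?case using bea_iter_inv by blast
qed

text \<open>One symmetric pair of entries gives enough freedom. Setting this entry of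
  \<open>A (t + 1)\<close> to 1 makes its product with \<open>E\<close> equal to 2, so each
  \<open>X j\<close> can be shifted along \<open>E\<close> to meet its own equation; no two of these
  equations share an \<open>X j\<close>.\<close>

lemma bea_iter_exists:
  fixes P Q :: "nat \<Rightarrow> 'n::finite set"
  assumes inv: "bea_inv k l P Q t A X" and t: "t + 1 \<le> k + 1" and l: "1 \<le> l"
  shows "\<exists>A' X'. bea_iter k l P Q (t + 1) A X A' X'"
proof -
  have init: "bea_init k l P Q A X" and t1: "1 \<le> t" using inv by (auto simp: bea_inv_def)
  note I = bea_initD[OF init]
  obtain r where r: "r \<in> P t" using I(3)[of t] t t1 by auto
  obtain s where s: "s \<in> Q 1" using I(4)[of 1] l by auto
  have rs: "r \<noteq> s" using I(6)[of t] r s t t1 by auto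
  define E :: "real^'n^'n" where "E = (\<chi> i j. if i = r \<and> j = s \<or> i = s \<and> j = r then 1 else 0)"
  have symE: "sym_mat E" by (auto simp: E_def sym_mat_iff)
  have BE: "B \<bullet>\<^sub>S E = 2 * B $ r $ s" if "sym_mat B" for B
  proof -
    have "E $ j $ i = (if i = r then if j = s then 1 else 0 else 0)
        + (if i = s then if j = r then 1 else 0 else 0)" for i j
      using rs by (auto simp: E_def)
    moreover have "(\<Sum>j\<in>UNIV. if c then g j else 0) = (if c then \<Sum>j\<in>UNIV. g j else 0)"
      for c and g :: "'n \<Rightarrow> real" by simp
    ultimately have "B \<bullet>\<^sub>S E = B $ r $ s + B $ s $ r"
      by (simp add: mat_prod_sum distrib_left sum.distrib if_distrib[of "\<lambda>x. _ * x"] cong: if_cong)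
    then show ?thesis using sym_mat_entry[OF that, of s r] by simp
  qed
  have re: "reset_block (P t) (Q 1) M (M + c *\<^sub>R E)" if "sym_mat M" for M c
    using that symE r s by (auto simp: reset_block_def sym_mat_add sym_mat_scaleR E_def)
  define B where "B = A (t + 1) + (1 - A (t + 1) $ r $ s) *\<^sub>R E"
  have At: "sym_mat (A (t + 1))" using echelon_atD(1)[OF echelon_structD[OF I(1)]] t by simp
  have Xj: "sym_mat (X j)" if "j \<in> {2..l + 1}" for j
    using echelon_atD(1)[OF echelon_structD[OF I(2)]] that by simp
  have B: "sym_mat B" "B \<bullet>\<^sub>S E = 2"
  proof -
    show "sym_mat B" using At symE by (simp add: B_def sym_mat_add sym_mat_scaleR)
    moreover have "B $ r $ s = 1" by (simp add: B_def E_def)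
    ultimately show "B \<bullet>\<^sub>S E = 2" using BE by simp
  qed
  define target :: "nat \<Rightarrow> real" where "target = (\<lambda>j. if (t + 1, j) = (k + 1, l + 1) then - 1 else 0)"
  define A' where "A' = A(t + 1 := B)"
  define X' where "X' = (\<lambda>j. if j \<in> {2..l + 1} then X j + ((target j - B \<bullet>\<^sub>S X j) / 2) *\<^sub>R E else X j)"
  have "bea_iter k l P Q (t + 1) A X A' X'"
    unfolding bea_iter_def
  proof (intro conjI ballI allI impI)
    show "reset_block (P (t + 1 - 1)) (Q 1) (A (t + 1)) (A' (t + 1))"
      using re[OF At] by (simp add: A'_def B_def)
    fix j assume j: "j \<in> {2..l + 1}"
    show "reset_block (P (t + 1 - 1)) (Q 1) (X j) (X' j)" using re[OF Xj[OF j]] j by (simp add: X'_def)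
    show "base_eq k l A' X' (t + 1) j"
      using j B(2) by (simp add: base_eq_def A'_def X'_def mat_prod_add_right mat_prod_scaleR_right target_def
          field_simps)
  qed (auto simp: A'_def X'_def)
  then show ?thesis by blast
qed

lemma bea_run_constant:
  assumes init: "bea_init k l P Q A X" and base: "base_eqs k l A X" and t: "1 \<le> t" "t \<le> k + 1"
  shows "bea_run k l P Q t A X"
  using t
proof (induction t rule: nat_induct_at_least)
  case base
  show ?case by (rule bea_run.init[OF init])
next
  case (Suc t)
  note I = bea_initD[OF init]
  have "bea_iter k l P Q (t + 1) A X A X"
    using Suc.hyps Suc.prems base echelon_atD(1)[OF echelon_structD[OF I(1)]]
      echelon_atD(1)[OF echelon_structD[OF I(2)]]
    by (auto simp: bea_iter_def reset_block_def base_eqs_def)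
  then show ?case using bea_run.iter[of k l P Q t A X A X] Suc by simp
qed

lemma wi_step1_inv:
  assumes "wi_step1 m k l A X"
  obtains P Q where "bea_init k l P Q A X" "base_eqs k l A X"
proof -
  obtain P Q where "bea_run k l P Q (k + 1) A X" "1 \<le> k" "1 \<le> l"
    using assms by (auto simp: wi_step1_def bea_output_def)
  then have "bea_inv k l P Q (k + 1) A X" by (rule bea_run_inv)
  then show thesis using that by (auto simp: bea_inv_def base_eqs_def)
qed

section \<open>Soundness\<close>

text \<open>Where the product with \<open>A i\<close> vanishes, positivity of the weights forces the
  diagonal of \<open>Y\<close> to vanish on \<open>P i\<close>, and semidefiniteness then the whole
  rows. After \<open>k\<close> steps \<open>Y\<close> meets only the positive diagonal block of
  \<open>A (k + 1)\<close>. A right-hand side of -1 is thus infeasible.\<close>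

lemma echelon_last_nonneg:
  assumes A: "echelon_struct (k + 1) A P" and Y: "Y \<in> psd_cone"
    and eq: "\<And>i. i \<in> {1..k} \<Longrightarrow> A i \<bullet>\<^sub>S Y = 0"
  shows "0 \<le> A (k + 1) \<bullet>\<^sub>S Y"
proof -
  have symY: "sym_mat Y" and psd: "psd_on UNIV Y" using Y by (auto simp: psd_cone_iff)
  have entry: "Y $ r $ s = axis r 1 \<bullet> (Y *v axis s 1)" for r s
    by (simp add: inner_axis' matrix_vector_mult_basis column_def)
  have diag: "0 \<le> Y $ r $ r" for r unfolding entry using psd by (rule psd_onD) simp
  have null: "Y $ r $ s = 0" if "Y $ r $ r = 0" for r s
  proof -
    have "axis s 1 \<bullet> (Y *v axis r 1) = 0"
      using that unfolding entry by (rule psd_on_null[OF subspace_UNIV symY psd UNIV_I _ UNIV_I])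
    then have "Y $ s $ r = 0" unfolding entry .
    then show ?thesis using sym_mat_entry[OF symY, of r s] by simp
  qed
  have van: "i \<le> k + 1 \<longrightarrow> (\<forall>r\<in>(\<Union>j\<in>{1..<i}. P j). \<forall>s. Y $ r $ s = 0)" for i
  proof (induction i)
    case (Suc i)
    show ?case
    proof (intro impI ballI allI)
      fix r s assume ik: "Suc i \<le> k + 1" and r: "r \<in> (\<Union>j\<in>{1..<Suc i}. P j)"
      have IH: "\<forall>r\<in>(\<Union>j\<in>{1..<i}. P j). \<forall>s. Y $ r $ s = 0" using Suc ik by simp
      show "Y $ r $ s = 0"
      proof (cases "r \<in> (\<Union>j\<in>{1..<i}. P j)")
        case False
        then have i: "1 \<le> i" "r \<in> P i" using r by (auto simp: less_Suc_eq)
        then have i': "i \<in> {1..k}" "i \<in> {1..k + 1}" using ik by auto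
        note Ai = echelon_structD[OF A i'(2)]
        have "(\<Sum>r\<in>P i. A i $ r $ r * Y $ r $ r) = 0"
          using echelon_mat_prod[OF Ai symY] IH eq[OF i'(1)] by simp
        moreover have "0 \<le> A i $ r $ r * Y $ r $ r" if "r \<in> P i" for r
          using echelon_atD(3)[OF Ai that] diag by simp
        ultimately have "A i $ r $ r * Y $ r $ r = 0"
          using i(2) by (subst (asm) sum_nonneg_eq_0_iff) auto
        then show ?thesis using echelon_atD(3)[OF Ai i(2)] null[of r s] by simp
      qed (use IH in blast)
    qed
  qed simp
  have k: "k + 1 \<in> {1..k + 1}" by simp
  note Ak = echelon_structD[OF A k]
  have "A (k + 1) \<bullet>\<^sub>S Y = (\<Sum>r\<in>P (k + 1). A (k + 1) $ r $ r * Y $ r $ r)"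
    using echelon_mat_prod[OF Ak symY] van[of "k + 1"] by blast
  also have "0 \<le> \<dots>" using echelon_atD(3)[OF Ak] diag by (intro sum_nonneg) (simp add: less_imp_le)
  finally show ?thesis .
qed

text \<open>Otherwise, unit vectors of \<open>S\<close> violating the inequality for \<open>t = 0, 1, 2, \<dots>\<close> accumulate at a unit
  vector \<open>v\<close> with \<open>v \<bullet> X v = 0\<close> and \<open>v \<bullet> M v \<le> - \<epsilon>\<close>.\<close>

lemma psd_on_lift:
  fixes M X :: "real^'n^'n"
  assumes S: "subspace S" and X: "psd_on S X"
    and M: "\<And>v. v \<in> S \<Longrightarrow> v \<bullet> (X *v v) = 0 \<Longrightarrow> 0 \<le> v \<bullet> (M *v v)" and "0 < \<epsilon>"
  shows "\<exists>t. psd_on S (M + t *\<^sub>R X + \<epsilon> *\<^sub>R mat 1)"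
proof (rule ccontr)
  assume neg: "\<nexists>t. psd_on S (M + t *\<^sub>R X + \<epsilon> *\<^sub>R mat 1)"
  define q where "q = (\<lambda>v. v \<bullet> (X *v v))"
  define h where "h = (\<lambda>v. v \<bullet> (M *v v))"
  have val: "v \<bullet> ((M + t *\<^sub>R X + \<epsilon> *\<^sub>R mat 1) *v v) = h v + t * q v + \<epsilon> * (norm v)^2" for v t
    by (simp add: h_def q_def matrix_vector_mult_add_rdistrib scaleR_matrix_vector inner_add_right
        power2_norm_eq_inner)
  define C where "C = S \<inter> sphere 0 1"
  have C: "compact C" unfolding C_def using closed_subspace[OF S] by (intro closed_Int_compact) auto
  have "\<exists>v\<in>C. h v + real n * q v + \<epsilon> < 0" for n
  proof -
    obtain v where v: "v \<in> S" "h v + real n * q v + \<epsilon> * (norm v)^2 < 0"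
      using neg unfolding psd_on_def val by (meson not_le)
    then have "v \<noteq> 0" by (auto simp: h_def q_def)
    define u where "u = (1 / norm v) *\<^sub>R v"
    have "h u + real n * q u + \<epsilon> = (1 / norm v)^2 * (h v + real n * q v + \<epsilon> * (norm v)^2)"
      using \<open>v \<noteq> 0\<close>
      by (simp add: u_def h_def q_def matrix_vector_mult_scaleR power2_eq_square field_simps)
    also have "\<dots> < 0" using v(2) \<open>v \<noteq> 0\<close> by (intro mult_pos_neg) auto
    finally show ?thesis using v \<open>v \<noteq> 0\<close> S by (auto simp: C_def u_def subspace_scale)
  qed
  then obtain w where w: "\<And>n. w n \<in> C" "\<And>n. h (w n) + real n * q (w n) + \<epsilon> < 0" by metis
  obtain v \<sigma> where v: "v \<in> C" "strict_mono \<sigma>" "(w \<circ> \<sigma>) \<longlonglongrightarrow> v"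
    using C w(1) unfolding compact_def by metis
  have "continuous_on UNIV h" "continuous_on UNIV q" unfolding h_def q_def
    by (intro continuous_intros matrix_vector_mult_linear_continuous_on)+
  then have lim: "(\<lambda>n. h (w (\<sigma> n))) \<longlonglongrightarrow> h v" "(\<lambda>n. q (w (\<sigma> n))) \<longlonglongrightarrow> q v"
    using v(3) by (auto simp: continuous_on_eq_continuous_at isCont_def o_def
        intro: continuous_within_tendsto_compose' isCont_tendsto_compose)
  have wS: "0 \<le> q (w n)" for n using psd_onD[OF X] w(1) by (auto simp: C_def q_def)
  have hneg: "h (w (\<sigma> n)) \<le> - \<epsilon>" for n
  proof -
    have "0 \<le> real (\<sigma> n) * q (w (\<sigma> n))" using wS by simp
    then show ?thesis using w(2)[of "\<sigma> n"] by linarith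
  qed
  then have hv: "h v \<le> - \<epsilon>" using lim(1) by (intro LIMSEQ_le_const2) auto
  have qle: "real n * q (w (\<sigma> n)) \<le> - h (w (\<sigma> n))" for n
  proof -
    have "real n * q (w (\<sigma> n)) \<le> real (\<sigma> n) * q (w (\<sigma> n))"
      using seq_suble[OF v(2)] wS by (intro mult_right_mono) auto
    then show ?thesis using w(2)[of "\<sigma> n"] \<open>0 < \<epsilon>\<close> by linarith
  qed
  have "q v = 0"
  proof (rule ccontr)
    assume "q v \<noteq> 0"
    moreover have "0 \<le> q v" using psd_onD[OF X] v(1) by (auto simp: C_def q_def)
    ultimately have "0 < q v" by simp
    then have "filterlim (\<lambda>n. q (w (\<sigma> n)) * real n) at_top sequentially"
      using filterlim_tendsto_pos_mult_at_top[OF lim(2) _ filterlim_real_sequentially] by blast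
    moreover have "\<forall>\<^sub>F n in sequentially. q (w (\<sigma> n)) * real n \<le> - h (w (\<sigma> n))"
      using qle by (simp add: mult.commute)
    ultimately have "filterlim (\<lambda>n. - h (w (\<sigma> n))) at_top sequentially"
      by (rule filterlim_at_top_mono)
    moreover have "(\<lambda>n. - h (w (\<sigma> n))) \<longlonglongrightarrow> - h v" using lim(1) by (rule tendsto_minus)
    ultimately show False
      using not_tendsto_and_filterlim_at_infinity[of sequentially "\<lambda>n. - h (w (\<sigma> n))"]
        filterlim_at_top_imp_at_infinity by (metis sequentially_bot)
  qed
  then show False using M[of v] v(1) hv \<open>0 < \<epsilon>\<close> by (auto simp: C_def q_def h_def)
qed

text \<open>The coordinate subspaces \<open>V i\<close> are climbed from \<open>V l\<close>, where
  \<open>X (l + 1)\<close> is positive semidefinite, up to \<open>V 0\<close>, the whole space.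
  Since null vectors of \<open>X (i + 1)\<close> in \<open>V i\<close> lie in
  \<open>V (i + 1)\<close>, \<open>psd_on_lift\<close> extends positivity at each step, at the price
  of a small multiple of the identity.\<close>

lemma echelon_nearly_psd:
  assumes X: "echelon_struct (l + 1) X Q" and "0 < \<epsilon>"
  shows "\<exists>c \<delta>. 0 \<le> \<delta> \<and> \<delta> < \<epsilon> \<and> psd_on UNIV (X (l + 1) + (\<Sum>j\<in>{1..l}. c j *\<^sub>R X j) + \<delta> *\<^sub>R mat 1)"
proof -
  define V where "V = (\<lambda>i. {v :: real^'a. \<forall>r\<in>(\<Union>j\<in>{1..i}. Q j). v $ r = 0})"
  have V: "subspace (V i)" for i by (auto simp: V_def subspace_def)
  have form: "v \<bullet> (X (i + 1) *v v) = (\<Sum>r\<in>Q (i + 1). X (i + 1) $ r $ r * (v $ r)^2)"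
    if "v \<in> V i" "i \<le> l" for v i
  proof -
    have "i + 1 \<in> {1..l + 1}" using that(2) by simp
    note Xi = echelon_structD[OF X this]
    \<comment> \<open>The quadratic form at \<open>v\<close> is the trace product with
      \<open>v v\<^sup>T\<close>, whose rows vanish where \<open>v\<close> does, so that
      \<open>echelon_mat_prod\<close> applies.\<close>
    define Y :: "real^'a^'a" where "Y = (\<chi> r s. v $ r * v $ s)"
    have "v \<bullet> (X (i + 1) *v v) = X (i + 1) \<bullet>\<^sub>S Y"
      by (simp add: inner_vec_def matrix_vector_mult_def mat_prod_sum Y_def sum_distrib_left algebra_simps)
    also have "\<dots> = (\<Sum>r\<in>Q (i + 1). X (i + 1) $ r $ r * Y $ r $ r)"
      by (rule echelon_mat_prod[OF Xi])
        (use that(1) in \<open>auto simp: Y_def sym_mat_iff V_def atLeastLessThanSuc_atLeastAtMost\<close>)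
    finally show ?thesis by (simp add: Y_def power2_eq_square)
  qed
  have nonneg: "0 \<le> X (i + 1) $ r $ r * (v $ r)^2" if "r \<in> Q (i + 1)" "i \<le> l" for i r and v :: "real^'a"
  proof -
    have "i + 1 \<in> {1..l + 1}" using that(2) by simp
    then show ?thesis using echelon_atD(3)[OF echelon_structD[OF X] that(1)] by simp
  qed
  have psd: "psd_on (V i) (X (i + 1))" if "i \<le> l" for i
    unfolding psd_on_def using form nonneg that by (simp add: sum_nonneg)
  have null: "v \<in> V (i + 1)" if "v \<in> V i" "i \<le> l" "v \<bullet> (X (i + 1) *v v) = 0" for v i
  proof -
    have "i + 1 \<in> {1..l + 1}" using that(2) by simp
    note Xi = echelon_structD[OF X this]
    have "v $ r = 0" if r: "r \<in> Q (i + 1)" for r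
    proof -
      have "X (i + 1) $ r $ r * (v $ r)^2 = 0"
        using sum_nonneg_0[of "Q (i + 1)" "\<lambda>r. X (i + 1) $ r $ r * (v $ r)^2" r] r
          nonneg[OF _ \<open>i \<le> l\<close>] form[OF \<open>v \<in> V i\<close> \<open>i \<le> l\<close>] \<open>v \<bullet> _ = 0\<close> by simp
      then show ?thesis using echelon_atD(3)[OF Xi r] by simp
    qed
    then show ?thesis using that(1) by (auto simp: V_def atLeastAtMostSuc_conv le_Suc_eq)
  qed
  have "\<exists>c \<delta>. 0 \<le> \<delta> \<and> \<delta> < \<epsilon> \<and>
      psd_on (V (l - i)) (X (l + 1) + (\<Sum>j\<in>{l - i + 1..l}. c j *\<^sub>R X j) + \<delta> *\<^sub>R mat 1)"
    if "i \<le> l" for i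
    using that
  proof (induction i)
    case 0
    show ?case using psd[of l] \<open>0 < \<epsilon>\<close> by (intro exI[of _ "\<lambda>_. 0"] exI[of _ "0::real"]) simp
  next
    case (Suc i)
    then obtain c \<delta> where d: "0 \<le> \<delta>" "\<delta> < \<epsilon>" and
      p: "psd_on (V (l - i)) (X (l + 1) + (\<Sum>j\<in>{l - i + 1..l}. c j *\<^sub>R X j) + \<delta> *\<^sub>R mat 1)"
      (is "psd_on _ ?M") by auto
    define h where "h = l - Suc i"
    have h: "h + 1 = l - i" "h \<le> l" "h + 1 \<le> l" using Suc.prems by (auto simp: h_def)
    \<comment> \<open>Half of the remaining margin, so that the accumulated error stays below
      \<open>\<epsilon>\<close> at every stage.\<close>
    define \<eta> where "\<eta> = (\<epsilon> - \<delta>) / 2"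
    have e: "0 < \<eta>" "\<delta> + \<eta> < \<epsilon>" using d by (simp_all add: \<eta>_def field_simps)
    obtain t where lam: "psd_on (V h) (?M + t *\<^sub>R X (h + 1) + \<eta> *\<^sub>R mat 1)"
      using psd_on_lift[OF V psd[OF h(2)], of ?M \<eta>] null[OF _ h(2)] p e(1) h(1) by (auto simp: psd_on_def)
    have ins: "{l - Suc i + 1..l} = insert (h + 1) {l - i + 1..l}" using h by (auto simp: h_def)
    have "(\<Sum>j\<in>{l - Suc i + 1..l}. (c(h + 1 := t)) j *\<^sub>R X j)
        = t *\<^sub>R X (h + 1) + (\<Sum>j\<in>{l - i + 1..l}. c j *\<^sub>R X j)"
      unfolding ins using h(1) by (subst sum.insert) (auto intro!: sum.cong)
    then have "?M + t *\<^sub>R X (h + 1) + \<eta> *\<^sub>R mat 1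
        = X (l + 1) + (\<Sum>j\<in>{l - Suc i + 1..l}. (c(h + 1 := t)) j *\<^sub>R X j) + (\<delta> + \<eta>) *\<^sub>R mat 1"
      by (simp add: algebra_simps)
    then have "psd_on (V (l - Suc i))
        (X (l + 1) + (\<Sum>j\<in>{l - Suc i + 1..l}. (c(h + 1 := t)) j *\<^sub>R X j) + (\<delta> + \<eta>) *\<^sub>R mat 1)"
      using lam by (simp only: h_def)
    then show ?case using d e by (intro exI[of _ "c(h + 1 := t)"] exI[of _ "\<delta> + \<eta>"]) auto
  qed
  from this[of l] show ?thesis by (simp add: V_def)
qed

section \<open>Weak infeasibility and its invariance under reformulation\<close>

lemma affine_setD:
  assumes "X \<in> affine_set p"
  shows "sym_mat X" "(A, b) \<in> set p \<Longrightarrow> A \<bullet>\<^sub>S X = b"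
  using assms by (auto simp: affine_set_def)

lemma setdist_eq_0_iff_approx:
  assumes "S \<noteq> {}" "T \<noteq> {}"
  shows "setdist S T = 0 \<longleftrightarrow> (\<forall>\<epsilon>>0. \<exists>x\<in>S. \<exists>y\<in>T. dist x y < \<epsilon>)"
proof
  assume "setdist S T = 0"
  then show "\<forall>\<epsilon>>0. \<exists>x\<in>S. \<exists>y\<in>T. dist x y < \<epsilon>" using assms setdist_ltE by metis
next
  assume *: "\<forall>\<epsilon>>0. \<exists>x\<in>S. \<exists>y\<in>T. dist x y < \<epsilon>"
  have "setdist S T \<le> \<epsilon>" if \<epsilon>: "0 < \<epsilon>" for \<epsilon>
  proof -
    obtain x y where "x \<in> S" "y \<in> T" "dist x y < \<epsilon>" using * \<epsilon> by blast
    then show ?thesis using setdist_le_dist[of x S y T] by simp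
  qed
  then have "setdist S T \<le> 0" by (metis add_0 field_le_epsilon)
  then show "setdist S T = 0" using setdist_pos_le[of S T] by simp
qed

lemma zero_psd: "0 \<in> psd_cone"
  by (simp add: psd_cone_def sym_mat_0)

lemma weakly_infeasible_iff:
  "weakly_infeasible p \<longleftrightarrow> affine_set p \<inter> psd_cone = {} \<and> affine_set p \<noteq> {} \<and>
     (\<forall>\<epsilon>>0. \<exists>x\<in>affine_set p. \<exists>y\<in>psd_cone. dist x y < \<epsilon>)"
proof -
  have ne: "(psd_cone :: (real^'a^'a) set) \<noteq> {}" using zero_psd by blast
  show ?thesis
    unfolding weakly_infeasible_def using setdist_eq_0_iff_approx[OF _ ne, of "affine_set p"] by auto
qed

lemma psd_cone_congruence:
  fixes S :: "real^'n^'n"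
  shows "X \<in> psd_cone \<Longrightarrow> transpose S ** X ** S \<in> psd_cone"
  unfolding psd_cone_iff psd_on_def inner_congruence by (simp add: sym_mat_congruence)

lemma affine_set_congruence:
  fixes S T :: "real^'n^'n"
  assumes "transpose S ** T = mat 1" "X \<in> affine_set p"
  shows "transpose S ** X ** S \<in> affine_set (map (\<lambda>(A, b). (transpose T ** A ** T, b)) p)"
  using assms(2) mat_prod_congruence[OF assms(1)] by (auto simp: affine_set_def sym_mat_congruence)

lemma congruence_inverse:
  fixes T U :: "real^'n^'n"
  assumes "T ** U = mat 1"
  shows "map (\<lambda>(A, b). (transpose U ** A ** U, b)) (map (\<lambda>(A, b). (transpose T ** A ** T, b)) p) = p"
proof -
  have "transpose U ** transpose T = mat 1"
    using assms by (metis matrix_transpose_mul transpose_mat)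
  then have "transpose U ** (transpose T ** A ** T) ** U = A" for A
    using assms by (metis matrix_mul_assoc matrix_mul_lid matrix_mul_rid)
  then show ?thesis by (auto intro!: map_idI)
qed

lemma invertible_obtain_inverse:
  fixes T :: "real^'n^'n"
  assumes "invertible T"
  obtains U where "T ** U = mat 1" "U ** T = mat 1" "invertible U"
  using assms unfolding invertible_def by blast

text \<open>Each operation is undone by one of the same kind. Since \<open>reformulation\<close> is
  thus symmetric, the completeness proof may transform the given system into constructed data
  instead of the reverse.\<close>

lemma reform_step_sym:
  fixes p :: "'n::finite sdp"
  assumes "reform_step p q"
  shows "reform_step q p"
  using assms
proof cases
  case (exchange i j)
  have "p = q[i := q ! j, j := q ! i]"
    using exchange by (intro nth_equalityI) (auto simp: nth_list_update)
  then show ?thesis using reform_step.exchange[of i q j] exchange by simp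
next
  case (combine i j lam mu)
  have "p ! i = (1 / lam) *\<^sub>R (q ! i) + (- mu / lam) *\<^sub>R (q ! j)"
    using combine by (simp add: scaleR_add_right)
  then have "p = q[i := (1 / lam) *\<^sub>R (q ! i) + (- mu / lam) *\<^sub>R (q ! j)]"
    using combine by (metis list_update_id list_update_overwrite)
  then show ?thesis using reform_step.combine[of i q j "1 / lam" "- mu / lam"] combine by simp
next
  case (congruence T)
  obtain U where "T ** U = mat 1" "invertible U" using invertible_obtain_inverse[OF congruence(2)] .
  then show ?thesis using reform_step.congruence[of U q] congruence_inverse[of T U p] congruence(1) by simp
qed

lemma reformulation_sym:
  assumes "reformulation p q" shows "reformulation q p"
  using assms unfolding reformulation_def
proof (induction rule: rtranclp_induct)
  case (step q r)
  then show ?case using reform_step_sym converse_rtranclp_into_rtranclp by metis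
qed simp

lemma reformulation_trans: "reformulation p q \<Longrightarrow> reformulation q r \<Longrightarrow> reformulation p r"
  unfolding reformulation_def by (rule rtranclp_trans)

lemma reform_step_is_sdp:
  fixes p :: "'n::finite sdp"
  assumes "reform_step p q" "is_sdp p"
  shows "is_sdp q"
  using assms(1)
proof cases
  case (exchange i j)
  then show ?thesis using assms(2) set_swap[of i p j] by (simp add: is_sdp_def)
next
  case (combine i j lam mu)
  have "sym_mat (fst (p ! i))" "sym_mat (fst (p ! j))"
    using assms(2) combine nth_mem[of i p] nth_mem[of j p] by (auto simp: is_sdp_def split_beta)
  then have "sym_mat (fst (lam *\<^sub>R (p ! i) + mu *\<^sub>R (p ! j)))"
    by (simp add: sym_mat_add sym_mat_scaleR)
  then show ?thesis using assms(2) set_update_subset_insert[of p i] combine(1)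
    by (fastforce simp: is_sdp_def split_beta)
next
  case (congruence T)
  then show ?thesis using assms(2) by (auto simp: is_sdp_def sym_mat_congruence)
qed

lemma affine_set_combine:
  assumes "X \<in> affine_set p" "i < length p" "j < length p"
  shows "X \<in> affine_set (p[i := lam *\<^sub>R (p ! i) + mu *\<^sub>R (p ! j)])"
proof -
  have eq: "fst q \<bullet>\<^sub>S X = snd q" if "q \<in> set p" for q
    using assms(1) that by (auto simp: affine_set_def)
  have "fst q \<bullet>\<^sub>S X = snd q" if "q = lam *\<^sub>R (p ! i) + mu *\<^sub>R (p ! j)" for q
    using that eq[of "p ! i"] eq[of "p ! j"] assms(2,3)
    by (simp add: mat_prod_add_left mat_prod_scaleR_left)
  then have "fst q \<bullet>\<^sub>S X = snd q" if "q \<in> set (p[i := lam *\<^sub>R (p ! i) + mu *\<^sub>R (p ! j)])" for q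
    using eq that set_update_subset_insert[of p i] by blast
  then show ?thesis using assms(1) by (auto simp: affine_set_def split_beta)
qed

lemma linear_congruence: "linear (\<lambda>X. transpose S ** X ** S)" for S :: "real^'n^'n"
  by (intro linearI)
    (simp_all add: vec_eq_iff matrix_matrix_mult_def algebra_simps sum.distrib sum_distrib_left sum_distrib_right)

text \<open>With \<open>U\<close> the inverse of \<open>T\<close>, \<open>\<Phi>\<close> maps
  solutions of the affine equations to solutions and the cone into itself. It need not be an
  isometry, but it stretches distances at most by the factor \<open>B\<close>, so distance 0 is
  preserved; infeasibility is carried over by the inverse map.\<close>

lemma weakly_infeasible_congruence:
  fixes p :: "'n::finite sdp" and T :: "real^'n^'n"
  assumes "invertible T" and wi: "weakly_infeasible p"
  shows "weakly_infeasible (map (\<lambda>(A, b). (transpose T ** A ** T, b)) p)" (is "weakly_infeasible ?q")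
proof -
  obtain U where U: "T ** U = mat 1" "U ** T = mat 1" using invertible_obtain_inverse[OF assms(1)] .
  define \<Phi> where "\<Phi> = (\<lambda>X. transpose (transpose U) ** X ** transpose U)"
  have to: "\<Phi> X \<in> affine_set ?q" if "X \<in> affine_set p" for X
    using affine_set_congruence[of "transpose U" T X p] that U by (simp add: \<Phi>_def)
  have "linear \<Phi>" unfolding \<Phi>_def by (rule linear_congruence)
  then obtain B where B: "B > 0" "\<And>X. norm (\<Phi> X) \<le> B * norm X" using linear_bounded_pos by blast
  have wi': "affine_set p \<inter> psd_cone = {}" "affine_set p \<noteq> {}"
    "\<And>\<epsilon>. \<epsilon> > 0 \<Longrightarrow> \<exists>x\<in>affine_set p. \<exists>y\<in>psd_cone. dist x y < \<epsilon>"
    using wi unfolding weakly_infeasible_iff by auto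
  show ?thesis unfolding weakly_infeasible_iff
  proof (intro conjI allI impI)
    have "transpose (transpose T) ** Y ** transpose T \<in> affine_set p \<inter> psd_cone"
      if "Y \<in> affine_set ?q" "Y \<in> psd_cone" for Y
      using affine_set_congruence[of "transpose T" U Y ?q] congruence_inverse[OF U(1), of p]
        psd_cone_congruence[of Y "transpose T"] that U by simp
    then show "affine_set ?q \<inter> psd_cone = {}" using wi'(1) by blast
    show "affine_set ?q \<noteq> {}" using wi'(2) to by blast
    fix \<epsilon> :: real assume "0 < \<epsilon>"
    then obtain x y where xy: "x \<in> affine_set p" "y \<in> psd_cone" "dist x y < \<epsilon> / B"
      using wi'(3)[of "\<epsilon> / B"] B(1) by auto
    have "dist (\<Phi> x) (\<Phi> y) = norm (\<Phi> (x - y))" using \<open>linear \<Phi>\<close> by (simp add: dist_norm linear_diff)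
    also have "\<dots> \<le> B * norm (x - y)" by (rule B(2))
    also have "\<dots> < \<epsilon>" using xy(3) B(1) by (simp add: dist_norm field_simps)
    finally show "\<exists>x\<in>affine_set ?q. \<exists>y\<in>psd_cone. dist x y < \<epsilon>"
      using to[OF xy(1)] psd_cone_congruence[OF xy(2), of "transpose U"] by (auto simp: \<Phi>_def)
  qed
qed

lemma reform_step_weakly_infeasible:
  fixes p :: "'n::finite sdp"
  assumes "reform_step p q" "weakly_infeasible p"
  shows "weakly_infeasible q"
  using assms(1)
proof cases
  case (exchange i j)
  then have "affine_set q = affine_set p" using set_swap[of i p j] by (simp add: affine_set_def)
  then show ?thesis using assms(2) by (simp add: weakly_infeasible_def)
next
  case (combine i j lam mu)
  have "affine_set p \<subseteq> affine_set q" using affine_set_combine combine by blast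
  moreover have "affine_set q \<subseteq> affine_set p"
  proof
    fix X assume "X \<in> affine_set q"
    then have "X \<in> affine_set (q[i := (1 / lam) *\<^sub>R (q ! i) + (- mu / lam) *\<^sub>R (q ! j)])"
      using combine by (intro affine_set_combine) auto
    moreover have "q[i := (1 / lam) *\<^sub>R (q ! i) + (- mu / lam) *\<^sub>R (q ! j)] = p"
      using combine by (simp add: scaleR_add_right)
    ultimately show "X \<in> affine_set p" by simp
  qed
  ultimately show ?thesis using assms(2) by (simp add: weakly_infeasible_def)
next
  case (congruence T)
  then show ?thesis using weakly_infeasible_congruence assms(2) by simp
qed

lemma reformulation_sound:
  assumes "reformulation p q" "is_sdp p" "weakly_infeasible p"
  shows "is_sdp q \<and> weakly_infeasible q"
  using assms unfolding reformulation_def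
  by (induction rule: rtranclp_induct) (auto intro: reform_step_is_sdp reform_step_weakly_infeasible)

section \<open>Weak infeasibility of the constructed system\<close>

lemma set_wi_data: "set (wi_data m k l A X) = (\<lambda>i. (A i, wi_rhs k l A X i)) ` {1..m}"
proof -
  have "{1..<m + 1} = {1..m}" by auto
  then show ?thesis by (simp only: wi_data_def set_map set_upt)
qed

text \<open>The constraints \<open>1, ..., k + 1\<close> already exclude a semidefinite solution.
  The others respect the approximation: \<open>X (l + 1)\<close> satisfies them by the choice of the
  right-hand sides, and adding combinations of \<open>X 1, ..., X l\<close> does not leave the
  affine set.\<close>

lemma wi_data_sound:
  assumes s1: "wi_step1 m k l A X" and s3: "wi_step3 m k l A X A'"
  shows "is_sdp (wi_data m k l A' X) \<and> weakly_infeasible (wi_data m k l A' X)"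
proof -
  obtain P Q where init: "bea_init k l P Q A X" and base: "base_eqs k l A X"
    using s1 by (rule wi_step1_inv)
  have kl: "1 \<le> k" "1 \<le> l" "k + 1 \<le> m" using s1 by (auto simp: wi_step1_def)
  note I = bea_initD[OF init]
  have A'A: "A' i = A i" if "i \<in> {1..k + 1}" for i using s3 that by (auto simp: wi_step3_def)
  have A'_new: "sym_mat (A' i)" "\<And>j. j \<in> {1..l} \<Longrightarrow> A' i \<bullet>\<^sub>S X j = 0" if "i \<in> {k + 2..m}" for i
    using s3 that by (auto simp: wi_step3_def)
  have split: "i \<in> {1..k + 1} \<or> i \<in> {k + 2..m}" if "i \<in> {1..m}" for i using that by auto
  have symA: "sym_mat (A' i)" if "i \<in> {1..m}" for i
    using split[OF that] A'A A'_new echelon_atD(1)[OF echelon_structD[OF I(1)]] by auto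
  have be: "A i \<bullet>\<^sub>S X j = (if (i, j) = (k + 1, l + 1) then - 1 else 0)"
    if "i \<in> {1..k + 1}" "j \<in> {1..l + 1}" for i j
    using base that by (auto simp: base_eqs_def base_eq_def)
  have zero: "A' i \<bullet>\<^sub>S X j = 0" if "i \<in> {1..m}" "j \<in> {1..l}" for i j
    using split[OF that(1)] A'A A'_new be[of i j] that(2) by auto
  have last: "A' i \<bullet>\<^sub>S X (l + 1) = wi_rhs k l A' X i" if "i \<in> {1..m}" for i
    using split[OF that] A'A be[of i "l + 1"] by (auto simp: wi_rhs_def)
  have symX: "sym_mat (X j)" if "j \<in> {1..l + 1}" for j
    using echelon_atD(1)[OF echelon_structD[OF I(2) that]] .
  have member: "X (l + 1) + (\<Sum>j\<in>{1..l}. c j *\<^sub>R X j) \<in> affine_set (wi_data m k l A' X)" for c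
  proof -
    have "sym_mat (\<Sum>j\<in>{1..l}. c j *\<^sub>R X j)"
      using subspace_sum[OF subspace_sym_mat, of "{1..l}" "\<lambda>j. c j *\<^sub>R X j"] symX
      by (simp add: sym_mat_scaleR)
    moreover have "A' i \<bullet>\<^sub>S (\<Sum>j\<in>{1..l}. c j *\<^sub>R X j) = 0" if "i \<in> {1..m}" for i
      using zero[OF that] by (simp add: mat_prod_sum_right mat_prod_scaleR_right)
    ultimately show ?thesis using last symX[of "l + 1"]
      by (auto simp: affine_set_def set_wi_data mat_prod_add_right sym_mat_add)
  qed
  have "is_sdp (wi_data m k l A' X)" using symA by (auto simp: is_sdp_def set_wi_data)
  moreover have "weakly_infeasible (wi_data m k l A' X)" unfolding weakly_infeasible_iff
  proof (intro conjI allI impI)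
    show "affine_set (wi_data m k l A' X) \<noteq> {}" using member by blast
    show "affine_set (wi_data m k l A' X) \<inter> psd_cone = {}"
    proof (rule equals0I)
      fix Y assume "Y \<in> affine_set (wi_data m k l A' X) \<inter> psd_cone"
      then have Y: "Y \<in> affine_set (wi_data m k l A' X)" "Y \<in> psd_cone" by auto
      have val: "A i \<bullet>\<^sub>S Y = wi_rhs k l A' X i" if "i \<in> {1..k + 1}" for i
      proof -
        have "i \<in> {1..m}" using that kl(3) by auto
        then have "(A' i, wi_rhs k l A' X i) \<in> set (wi_data m k l A' X)"
          unfolding set_wi_data by blast
        then show ?thesis using affine_setD(2)[OF Y(1)] A'A[OF that] by simp
      qed
      have "A i \<bullet>\<^sub>S Y = 0" if "i \<in> {1..k}" for i using val[of i] that by (simp add: wi_rhs_def)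
      then have "0 \<le> A (k + 1) \<bullet>\<^sub>S Y" using echelon_last_nonneg[OF I(1) Y(2)] by blast
      then show False using val[of "k + 1"] by (simp add: wi_rhs_def)
    qed
    fix \<epsilon> :: real assume "0 < \<epsilon>"
    define N where "N = norm (mat 1 :: real^'a^'a) + 1"
    have N: "0 < N" by (simp add: N_def add_nonneg_pos)
    obtain c \<delta> where d: "0 \<le> \<delta>" "\<delta> < \<epsilon> / N"
      and psd: "psd_on UNIV (X (l + 1) + (\<Sum>j\<in>{1..l}. c j *\<^sub>R X j) + \<delta> *\<^sub>R mat 1)"
      using echelon_nearly_psd[OF I(2), of "\<epsilon> / N"] \<open>0 < \<epsilon>\<close> N by auto
    define Z where "Z = X (l + 1) + (\<Sum>j\<in>{1..l}. c j *\<^sub>R X j)"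
    have Z: "Z \<in> affine_set (wi_data m k l A' X)" using member by (simp add: Z_def)
    have "Z + \<delta> *\<^sub>R mat 1 \<in> psd_cone"
      using psd affine_setD(1)[OF Z] by (simp add: psd_cone_iff Z_def sym_mat_add sym_mat_scaleR sym_mat_1)
    moreover have "dist Z (Z + \<delta> *\<^sub>R mat 1) < \<epsilon>"
    proof -
      have "dist Z (Z + \<delta> *\<^sub>R mat 1) = \<delta> * norm (mat 1 :: real^'a^'a)" using d by (simp add: dist_norm)
      also have "\<dots> \<le> \<delta> * N" using d by (intro mult_left_mono) (auto simp: N_def)
      also have "\<dots> < \<epsilon>" using d N by (simp add: field_simps)
      finally show ?thesis .
    qed
    ultimately show "\<exists>x\<in>affine_set (wi_data m k l A' X). \<exists>y\<in>psd_cone. dist x y < \<epsilon>"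
      using Z by blast
  qed
  ultimately show ?thesis by blast
qed

lemma wi_output_sound: "wi_output p \<Longrightarrow> is_sdp p \<and> weakly_infeasible p"
  using wi_data_sound reformulation_sound unfolding wi_output_def by blast

section \<open>Theorems of the alternative\<close>

text \<open>\<open>C\<close> need not be closed and \<open>x\<close> may lie on its boundary, where
  only a supporting hyperplane exists; it is still strict on the relative interior. The strict
  inequality at one point is what later prevents a trivial facial reduction step.\<close>

lemma proper_separation:
  fixes C :: "'a::euclidean_space set"
  assumes C: "convex C" "C \<noteq> {}" and "x \<notin> C"
  obtains a where "\<And>y. y \<in> C \<Longrightarrow> a \<bullet> x \<le> a \<bullet> y" "\<exists>y\<in>C. a \<bullet> x < a \<bullet> y"
proof (cases "x \<in> closure C")
  case True
  have "x \<notin> rel_interior C" using \<open>x \<notin> C\<close> rel_interior_subset by blast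
  then obtain a where a: "\<And>y. y \<in> closure C \<Longrightarrow> a \<bullet> x \<le> a \<bullet> y"
    "\<And>y. y \<in> rel_interior C \<Longrightarrow> a \<bullet> x < a \<bullet> y"
    using supporting_hyperplane_relative_frontier[OF C(1) True] by metis
  obtain z where "z \<in> rel_interior C" using C rel_interior_eq_empty by blast
  then have "\<exists>y\<in>C. a \<bullet> x < a \<bullet> y" using a(2) rel_interior_subset by blast
  then show thesis using that a(1) closure_subset by blast
next
  case False
  then obtain a b where "a \<bullet> x < b" "\<And>y. y \<in> closure C \<Longrightarrow> b < a \<bullet> y"
    using separating_hyperplane_closed_point[of "closure C" x] C(1) by (auto simp: convex_closure)
  then have "a \<bullet> x < a \<bullet> y" if "y \<in> C" for y using closure_subset that by (meson less_trans subsetD)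
  then show thesis using that C(2) by (metis all_not_in_conv less_imp_le)
qed

definition outer :: "real^'n \<Rightarrow> real^'n^'n" where
  "outer v = (\<chi> r s. v $ r * v $ s)"

lemma inner_outer: "Y \<bullet> outer v = v \<bullet> (Y *v v)"
  by (simp add: outer_def inner_vec_def matrix_vector_mult_def sum_distrib_left algebra_simps)

lemma outer_psd: "outer v \<in> psd_cone"
proof -
  have "w \<bullet> (outer v *v w) = (v \<bullet> w)^2" for w
    by (simp add: outer_def inner_vec_def matrix_vector_mult_def sum_distrib_left sum_distrib_right
        power2_eq_square sum_product algebra_simps)
  then show ?thesis by (simp add: psd_cone_def sym_mat_iff outer_def mult.commute)
qed

lemma convex_cone_psd: "convex_cone (psd_cone :: (real^'n^'n) set)"
  unfolding convex_cone_iff psd_cone_def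
  by (auto simp: sym_mat_0 sym_mat_add sym_mat_scaleR matrix_vector_mult_add_rdistrib inner_add_right
      scaleR_matrix_vector)

lemma psd_cone_inner: "psd_cone = {X. sym_mat X} \<inter> (\<Inter>v. {X. 0 \<le> X \<bullet> outer v})"
  by (auto simp: psd_cone_def inner_outer)

lemma closed_psd_cone: "closed (psd_cone :: (real^'n^'n) set)"
  unfolding psd_cone_inner
  by (intro closed_Int closed_INT ballI closed_subspace subspace_sym_mat closed_Collect_le continuous_intros)

text \<open>The convex cone \<open>C\<close> generated by the \<open>v v\<^sup>T\<close>, \<open>v \<in> S\<close>, and the orthogonal complement of \<open>As\<close> does not
  contain \<open>x0\<close>, and \<open>Y\<close> properly separates the two.\<close>

lemma facial_reduction_alternative:
  fixes x0 :: "real^'n^'n"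
  assumes infeasible: "\<And>Z. Z \<in> psd_cone \<Longrightarrow> \<exists>A\<in>As. A \<bullet> Z \<noteq> A \<bullet> x0"
  shows "\<exists>Y\<in>span As. psd_on S Y \<and> (Y \<bullet> x0 = -1 \<or> Y \<bullet> x0 = 0 \<and> (\<exists>v\<in>S. v \<bullet> (Y *v v) \<noteq> 0))"
proof -
  define N where "N = (span As)\<^sup>\<bottom>"
  have N: "subspace N" by (simp add: N_def subspace_orthogonal_comp)
  define C where "C = convex_cone hull (outer ` S \<union> N)"
  have C: "convex_cone C" by (simp add: C_def convex_cone_convex_cone_hull)
  have gen: "outer ` S \<union> N \<subseteq> C" by (simp add: C_def hull_subset)
  \<comment> \<open>A decomposition \<open>x0 = z + n\<close> would make \<open>z\<close> feasible,
    so \<open>x0\<close> is kept out of \<open>C\<close> by placing \<open>C\<close> in the sum of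
    \<open>psd_cone\<close> and \<open>N\<close>, a convex cone itself.\<close>
  have "C \<subseteq> {z + n |z n. z \<in> psd_cone \<and> n \<in> N}"
    unfolding C_def
  proof (rule hull_minimal)
    have "outer v \<in> {z + n |z n. z \<in> psd_cone \<and> n \<in> N}" for v
      using outer_psd[of v] subspace_0[OF N] by force
    moreover have "n \<in> {z + n |z n. z \<in> psd_cone \<and> n \<in> N}" if "n \<in> N" for n
      using zero_psd that by force
    ultimately show "outer ` S \<union> N \<subseteq> {z + n |z n. z \<in> psd_cone \<and> n \<in> N}" by blast
    have "{z + n |z n. z \<in> psd_cone \<and> n \<in> N} = (\<Union>z\<in>psd_cone. \<Union>n\<in>N. {z + n})" by auto
    then show "convex_cone {z + n |z n. z \<in> psd_cone \<and> n \<in> N}"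
      using convex_cone_sums[OF convex_cone_psd subspace_imp_convex_cone[OF N]] by simp
  qed
  moreover have "x0 \<noteq> z + n" if z: "z \<in> psd_cone" and n: "n \<in> N" for z n
  proof
    assume x0: "x0 = z + n"
    have "A \<bullet> n = 0" if "A \<in> As" for A
      using n that by (auto simp: N_def orthogonal_comp_def orthogonal_def span_base)
    then show False using infeasible[OF z] by (auto simp: x0 inner_add_right)
  qed
  ultimately have "x0 \<notin> C" by blast
  moreover have "convex C" "C \<noteq> {}" using C by (auto simp: convex_cone_def)
  ultimately obtain Y where Y: "\<And>c. c \<in> C \<Longrightarrow> Y \<bullet> x0 \<le> Y \<bullet> c" "\<exists>c\<in>C. Y \<bullet> x0 < Y \<bullet> c"
    using proper_separation[of C x0] by metis
  have Y0: "Y \<bullet> x0 \<le> 0" using Y(1)[of 0] C by (simp add: convex_cone_iff)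
  have pos: "0 \<le> Y \<bullet> c" if c: "c \<in> C" for c
  proof (rule ccontr)
    assume neg: "\<not> 0 \<le> Y \<bullet> c"
    define t where "t = (\<bar>Y \<bullet> x0\<bar> + 1) / - (Y \<bullet> c)"
    have "0 \<le> t" using neg by (simp add: t_def divide_nonneg_neg)
    then have "t *\<^sub>R c \<in> C" using C c by (simp add: convex_cone_iff)
    from Y(1)[OF this] have "Y \<bullet> x0 \<le> t * (Y \<bullet> c)" by simp
    also have "t * (Y \<bullet> c) = - \<bar>Y \<bullet> x0\<bar> - 1" using neg by (simp add: t_def field_simps)
    finally show False by linarith
  qed
  have "Y \<bullet> n = 0" if "n \<in> N" for n
    using pos[of n] pos[of "- n"] gen that subspace_neg[OF N that] by force
  then have "Y \<in> N\<^sup>\<bottom>" by (simp add: orthogonal_comp_def orthogonal_def inner_commute)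
  then have span: "Y \<in> span As" using orthogonal_comp_self[OF subspace_span[of As]] by (simp add: N_def)
  have psd: "psd_on S Y" using pos gen by (force simp: psd_on_def inner_outer[symmetric])
  show ?thesis
  proof (cases "Y \<bullet> x0 = 0")
    case True
    \<comment> \<open>Otherwise \<open>Y\<close> vanishes on all generators of \<open>C\<close>,
      contrary to the properness of the separation.\<close>
    have "\<exists>v\<in>S. v \<bullet> (Y *v v) \<noteq> 0"
    proof (rule ccontr)
      assume "\<not> ?thesis"
      then have "outer ` S \<union> N \<subseteq> {c. Y \<bullet> c = 0}"
        using \<open>\<And>n. n \<in> N \<Longrightarrow> Y \<bullet> n = 0\<close> by (auto simp: inner_outer)
      then have "C \<subseteq> {c. Y \<bullet> c = 0}" unfolding C_def
        by (rule hull_minimal) (rule subspace_imp_convex_cone[OF subspace_hyperplane])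
      then show False using Y(2) True by auto
    qed
    then show ?thesis using span psd True by blast
  next
    case False
    define t where "t = inverse (- (Y \<bullet> x0))"
    have t: "0 \<le> t" "t * (Y \<bullet> x0) = -1" using False Y0 by (auto simp: t_def field_simps)
    define Y' where "Y' = t *\<^sub>R Y"
    have "Y' \<in> span As" unfolding Y'_def using span by (rule span_scale)
    moreover have "psd_on S Y'" using psd t(1) by (simp add: psd_on_def Y'_def scaleR_matrix_vector)
    moreover have "Y' \<bullet> x0 = -1" using t(2) by (simp add: Y'_def)
    ultimately show ?thesis by blast
  qed
qed

text \<open>An unbounded sequence of points of \<open>y0 + E\<close> approaching \<open>K\<close> yields, after normalization, a nonzero
  point of \<open>E \<inter> K\<close>.\<close>

lemma affine_cone_alternative:
  fixes K E :: "'a::euclidean_space set"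
  assumes K: "closed K" "\<And>x c. x \<in> K \<Longrightarrow> 0 \<le> c \<Longrightarrow> c *\<^sub>R x \<in> K" and E: "subspace E"
    and near: "\<And>\<epsilon>. 0 < \<epsilon> \<Longrightarrow> \<exists>e\<in>E. \<exists>z\<in>K. dist (y0 + e) z < \<epsilon>"
  shows "(\<exists>e\<in>E. y0 + e \<in> K) \<or> (\<exists>e\<in>E. e \<in> K \<and> e \<noteq> 0)"
proof -
  have "\<exists>e z. e \<in> E \<and> z \<in> K \<and> dist (y0 + e) z < inverse (real (Suc n))" for n
    using near[of "inverse (real (Suc n))"] by auto
  then obtain e z where ez: "\<And>n. e n \<in> E" "\<And>n. z n \<in> K"
    "\<And>n. dist (y0 + e n) (z n) < inverse (real (Suc n))"
    by metis
  have d0: "(\<lambda>n. dist (y0 + e n) (z n)) \<longlonglongrightarrow> 0"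
    by (rule tendsto_sandwich[OF _ _ tendsto_const LIMSEQ_inverse_real_of_nat])
      (use ez(3) in \<open>auto intro: always_eventually less_imp_le\<close>)
  show ?thesis
  proof (cases "bounded (range e)")
    case True
    then obtain x \<sigma> where x: "strict_mono \<sigma>" "(e \<circ> \<sigma>) \<longlonglongrightarrow> x"
      using bounded_imp_convergent_subsequence[OF True] by blast
    have xE: "x \<in> E"
      by (rule closed_sequentially[OF closed_subspace[OF E] _ x(2)]) (simp add: ez(1))
    have "(\<lambda>n. y0 + e (\<sigma> n)) \<longlonglongrightarrow> y0 + x"
      using x(2) unfolding o_def by (rule tendsto_add[OF tendsto_const])
    moreover have "(\<lambda>n. (y0 + e (\<sigma> n)) - z (\<sigma> n)) \<longlonglongrightarrow> 0"
      using LIMSEQ_subseq_LIMSEQ[OF d0 x(1)]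
      unfolding o_def dist_norm by (rule tendsto_norm_zero_cancel)
    ultimately have "(\<lambda>n. (y0 + e (\<sigma> n)) - ((y0 + e (\<sigma> n)) - z (\<sigma> n))) \<longlonglongrightarrow> y0 + x - 0"
      by (rule tendsto_diff)
    then have "(\<lambda>n. z (\<sigma> n)) \<longlonglongrightarrow> y0 + x" by simp
    then have "y0 + x \<in> K" by (rule closed_sequentially[OF K(1) ez(2)])
    then show ?thesis using xE by blast
  next
    case False
    have "\<exists>m. real n + 1 < norm (e m)" for n
    proof (rule ccontr)
      assume "\<nexists>m. real n + 1 < norm (e m)"
      then have "bounded (range e)" by (intro boundedI[of _ "real n + 1"]) (auto simp: not_less)
      with False show False by simp
    qed
    then obtain m where m: "\<And>n. real n + 1 < norm (e (m n))" by metis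
    have em: "e (m n) \<noteq> 0" for n using m[of n] by auto
    define d where "d = (\<lambda>n. (1 / norm (e (m n))) *\<^sub>R e (m n))"
    define w where "w = (\<lambda>n. (1 / norm (e (m n))) *\<^sub>R z (m n))"
    have "d n \<in> E \<inter> sphere 0 1" for n using em ez(1) E by (simp add: d_def subspace_scale)
    moreover have "compact (E \<inter> sphere 0 1)" using closed_subspace[OF E] by (intro closed_Int_compact) auto
    ultimately obtain x \<sigma> where x: "x \<in> E \<inter> sphere 0 1" "strict_mono \<sigma>" "(d \<circ> \<sigma>) \<longlonglongrightarrow> x"
      unfolding compact_def by metis
    have wK: "w n \<in> K" for n using ez(2) K(2) by (simp add: w_def)
    have le: "norm (d n - w n) \<le> (norm y0 + 1) * inverse (real (Suc n))" for n
    proof -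
      have "norm (e (m n) - z (m n)) \<le> norm (y0 + e (m n) - z (m n)) + norm y0"
        using norm_triangle_ineq4[of "y0 + e (m n) - z (m n)" y0] by (simp add: algebra_simps)
      also have "norm (y0 + e (m n) - z (m n)) \<le> 1"
        using ez(3)[of "m n"] inverse_le_1_iff[of "real (Suc (m n))"] by (simp add: dist_norm)
      finally have 1: "norm (e (m n) - z (m n)) \<le> norm y0 + 1" by simp
      have "d n - w n = inverse (norm (e (m n))) *\<^sub>R (e (m n) - z (m n))"
        by (simp add: d_def w_def scaleR_diff_right divide_inverse)
      then have "norm (d n - w n) = norm (e (m n) - z (m n)) * inverse (norm (e (m n)))"
        by (simp add: mult.commute)
      also have "\<dots> \<le> (norm y0 + 1) * inverse (real (Suc n))"
        using 1 m[of n] by (intro mult_mono le_imp_inverse_le) auto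
      finally show ?thesis .
    qed
    have "(\<lambda>n. (norm y0 + 1) * inverse (real (Suc n))) \<longlonglongrightarrow> (norm y0 + 1) * 0"
      by (rule tendsto_mult_left[OF LIMSEQ_inverse_real_of_nat])
    then have "(\<lambda>n. (norm y0 + 1) * inverse (real (Suc n))) \<longlonglongrightarrow> 0" by simp
    with always_eventually[OF allI[OF le]] have "(\<lambda>n. d n - w n) \<longlonglongrightarrow> 0"
      by (rule Lim_null_comparison)
    then have "((\<lambda>n. d n - w n) \<circ> \<sigma>) \<longlonglongrightarrow> 0" using x(2) by (rule LIMSEQ_subseq_LIMSEQ)
    with x(3) have "(\<lambda>n. d (\<sigma> n) - (d (\<sigma> n) - w (\<sigma> n))) \<longlonglongrightarrow> x - 0"
      unfolding o_def by (rule tendsto_diff)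
    then have "(\<lambda>n. w (\<sigma> n)) \<longlonglongrightarrow> x" by simp
    then have "x \<in> K" by (rule closed_sequentially[OF K(1) wK])
    then show ?thesis using x(1) by auto
  qed
qed

text \<open>Compression by a projection \<open>g\<close> onto \<open>S\<close> turns
  semidefiniteness on \<open>S\<close> into membership in the closed cone \<open>psd_cone\<close>,
  where \<open>affine_cone_alternative\<close> applies; near-solutions stay near, as
  \<open>\<rho>\<close> is bounded and maps the cone into itself. A nonzero compressed direction
  takes a nonzero value on \<open>S\<close>, since a positive semidefinite form with only zero
  values is zero.\<close>

lemma dual_facial_reduction_alternative:
  fixes x0 :: "real^'n^'n"
  assumes N: "subspace N" "\<And>n. n \<in> N \<Longrightarrow> sym_mat n" and x0: "sym_mat x0" and S: "subspace S"
    and near: "\<And>\<epsilon>. 0 < \<epsilon> \<Longrightarrow> \<exists>n\<in>N. \<exists>z\<in>psd_cone. dist (x0 + n) z < \<epsilon>"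
  shows "(\<exists>n\<in>N. psd_on S (x0 + n)) \<or> (\<exists>n\<in>N. psd_on S n \<and> (\<exists>v\<in>S. v \<bullet> (n *v v) \<noteq> 0))"
proof -
  obtain g :: "real^'n \<Rightarrow> real^'n" where g: "range g \<subseteq> S" "linear g" "\<And>v. v \<in> S \<Longrightarrow> g v = v"
    using linear_exists_left_inverse_on[of id S] S by (auto simp: linear_id)
  define p where "p = matrix g"
  define \<rho> where "\<rho> = (\<lambda>X. transpose p ** X ** p)"
  have rho: "v \<bullet> (\<rho> X *v w) = g v \<bullet> (X *v g w)" for X v w
    by (simp add: \<rho>_def inner_congruence p_def matrix_works g(2))
  have lin: "linear \<rho>" unfolding \<rho>_def by (rule linear_congruence)
  have psd: "psd_on S X" if "\<rho> X \<in> psd_cone" for X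
    unfolding psd_on_def
  proof
    fix v assume v: "v \<in> S"
    have "0 \<le> v \<bullet> (\<rho> X *v v)" using that by (simp add: psd_cone_def)
    then show "0 \<le> v \<bullet> (X *v v)" by (simp add: rho g(3)[OF v])
  qed
  obtain B where B: "B > 0" "\<And>X. norm (\<rho> X) \<le> B * norm X" using linear_bounded_pos[OF lin] by blast
  have "(\<exists>e\<in>\<rho> ` N. \<rho> x0 + e \<in> psd_cone) \<or> (\<exists>e\<in>\<rho> ` N. e \<in> psd_cone \<and> e \<noteq> 0)"
  proof (rule affine_cone_alternative)
    show "closed (psd_cone :: (real^'n^'n) set)" by (rule closed_psd_cone)
    show "c *\<^sub>R x \<in> psd_cone" if "x \<in> psd_cone" "0 \<le> c" for x :: "real^'n^'n" and c
      using convex_cone_psd that unfolding convex_cone_iff by blast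
    show "subspace (\<rho> ` N)" using lin N(1) by (rule linear_subspace_image)
    fix \<epsilon> :: real assume "0 < \<epsilon>"
    then obtain n z where nz: "n \<in> N" "z \<in> psd_cone" "dist (x0 + n) z < \<epsilon> / B"
      using near[of "\<epsilon> / B"] B(1) by auto
    have "dist (\<rho> x0 + \<rho> n) (\<rho> z) = norm (\<rho> (x0 + n - z))"
      using lin by (simp add: dist_norm linear_diff linear_add)
    also have "\<dots> \<le> B * norm (x0 + n - z)" by (rule B(2))
    also have "\<dots> < \<epsilon>" using nz(3) B(1) by (simp add: dist_norm field_simps)
    finally show "\<exists>e\<in>\<rho> ` N. \<exists>z\<in>psd_cone. dist (\<rho> x0 + e) z < \<epsilon>"
      using nz(1) psd_cone_congruence[OF nz(2), of p] by (auto simp: \<rho>_def)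
  qed
  then consider n where "n \<in> N" "\<rho> x0 + \<rho> n \<in> psd_cone" | n where "n \<in> N" "\<rho> n \<in> psd_cone" "\<rho> n \<noteq> 0"
    by blast
  then show ?thesis
  proof cases
    case 1
    then show ?thesis using psd[of "x0 + n"] lin by (auto simp: linear_add)
  next
    case 2
    have "\<exists>v\<in>S. v \<bullet> (n *v v) \<noteq> 0"
    proof (rule ccontr)
      assume neg: "\<not> ?thesis"
      have "g v \<bullet> (n *v g v) = 0" for v using neg g(1) by blast
      then have "v \<bullet> (\<rho> n *v v) = 0" for v by (simp add: rho)
      then have "w \<bullet> (\<rho> n *v v) = 0" for v w
        using psd_on_null[OF subspace_UNIV, of "\<rho> n" v w] 2(2) by (simp add: psd_cone_iff)
      then have "\<rho> n *v v = 0 *v v" for v by (metis inner_eq_zero_iff matrix_vector_mult_0)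
      then have "\<rho> n = 0" using matrix_eq by blast
      with 2(3) show False by simp
    qed
    then show ?thesis using 2 psd by blast
  qed
qed

text \<open>Each \<open>Mid\<close> form is nonzero on the radical reached so far and lowers its
  dimension, so a \<open>Fin\<close> form has to appear within finitely many steps. The two
  predicates let one argument serve both the constraints and the matrices of the affine set.\<close>

lemma fr_seq_exists:
  fixes Mid Fin :: "real^'n^'n \<Rightarrow> bool"
  assumes sym: "\<And>Y. Mid Y \<or> Fin Y \<Longrightarrow> sym_mat Y"
    and alt: "\<And>S. subspace S \<Longrightarrow> (\<exists>Y. Fin Y \<and> psd_on S Y) \<or>
      (\<exists>Y. Mid Y \<and> psd_on S Y \<and> (\<exists>v\<in>S. v \<bullet> (Y *v v) \<noteq> 0))"
  shows "\<exists>k M. fr_seq (k + 1) M \<and> Fin (M (k + 1)) \<and>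
    (\<forall>i\<in>{1..k}. Mid (M i) \<and> (\<exists>v\<in>flag M (i - 1). v \<bullet> (M i *v v) \<noteq> 0))"
proof (rule ccontr)
  assume "\<not> ?thesis"
  then have stuck: False if "fr_seq (k + 1) M" "Fin (M (k + 1))"
    "\<And>i. i \<in> {1..k} \<Longrightarrow> Mid (M i) \<and> (\<exists>v\<in>flag M (i - 1). v \<bullet> (M i *v v) \<noteq> 0)" for k M
    using that by blast
  have "\<exists>M. fr_seq k M \<and> dim (flag M k) + k \<le> DIM(real^'n) \<and>
      (\<forall>i\<in>{1..k}. Mid (M i) \<and> (\<exists>v\<in>flag M (i - 1). v \<bullet> (M i *v v) \<noteq> 0))" for k
  proof (induction k)
    case 0
    show ?case by (simp add: fr_seq_def)
  next
    case (Suc k)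
    then obtain M where M: "fr_seq k M" "dim (flag M k) + k \<le> DIM(real^'n)"
      "\<And>i. i \<in> {1..k} \<Longrightarrow> Mid (M i) \<and> (\<exists>v\<in>flag M (i - 1). v \<bullet> (M i *v v) \<noteq> 0)" by blast
    have old: "Mid ((M(k + 1 := Y)) i) \<and> (\<exists>v\<in>flag (M(k + 1 := Y)) (i - 1). v \<bullet> ((M(k + 1 := Y)) i *v v) \<noteq> 0)"
      if "sym_mat Y" "psd_on (flag M k) Y" "i \<in> {1..k}" for Y i
    proof -
      have "i - 1 \<le> k" "i \<noteq> k + 1" using that(3) by auto
      then show ?thesis using fr_seq_extend(2)[OF M(1) that(1,2), of "i - 1"] M(3)[OF that(3)] by simp
    qed
    have False if Y: "Fin Y" "psd_on (flag M k) Y" for Y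
    proof (rule stuck)
      have sY: "sym_mat Y" using Y(1) sym by blast
      show "fr_seq (k + 1) (M(k + 1 := Y))" by (rule fr_seq_extend(1)[OF M(1) sY Y(2)])
      show "Fin ((M(k + 1 := Y)) (k + 1))" using Y(1) by simp
      show "Mid ((M(k + 1 := Y)) i) \<and>
          (\<exists>v\<in>flag (M(k + 1 := Y)) (i - 1). v \<bullet> ((M(k + 1 := Y)) i *v v) \<noteq> 0)"
        if "i \<in> {1..k}" for i using old[OF sY Y(2) that] .
    qed
    then obtain Y v where Y: "Mid Y" "psd_on (flag M k) Y" and v: "v \<in> flag M k" "v \<bullet> (Y *v v) \<noteq> 0"
      using alt[OF subspace_flag[of M k]] by blast
    have sY: "sym_mat Y" using Y sym by blast
    define M' where "M' = M(k + 1 := Y)"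
    note ext = fr_seq_extend[OF M(1) sY Y(2), folded M'_def]
    have M'k: "M' (k + 1) = Y" by (simp add: M'_def)
    have "flag M' (Suc k) = rad (flag M k) Y" using ext(2)[of k] M'k by simp
    moreover have "v \<notin> rad (flag M k) Y" using v radD by blast
    ultimately have "flag M' (Suc k) \<subset> flag M k" using v(1) rad_subset by blast
    then have "dim (flag M' (Suc k)) < dim (flag M k)"
      by (intro dim_psubset) (simp only: span_eq_iff[THEN iffD2, OF subspace_flag])
    moreover have "Mid (M' i) \<and> (\<exists>v\<in>flag M' (i - 1). v \<bullet> (M' i *v v) \<noteq> 0)" if "i \<in> {1..Suc k}" for i
    proof (cases "i = k + 1")
      case True
      then show ?thesis using Y(1) v M'k ext(2)[of k] by auto
    next
      case False
      then show ?thesis using old[OF sY Y(2), folded M'_def] that by simp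
    qed
    ultimately show ?case using M(2) ext(1) by (intro exI[of _ M']) auto
  qed
  from this[of "DIM(real^'n) + 1"] show False by auto
qed

section \<open>Row operations\<close>

lemma span_set_nth:
  fixes p :: "'a::real_vector list"
  assumes "v \<in> span (set p)"
  obtains c where "v = (\<Sum>i<length p. c i *\<^sub>R p ! i)"
proof -
  define V where "V = range (\<lambda>c. \<Sum>i<length p. c i *\<^sub>R p ! i)"
  have "subspace V" unfolding subspace_def
  proof (intro conjI ballI allI)
    show "0 \<in> V" unfolding V_def by (rule range_eqI[of _ _ "\<lambda>_. 0"]) simp
    fix x y and t :: real assume "x \<in> V" "y \<in> V"
    then obtain c d where "x = (\<Sum>i<length p. c i *\<^sub>R p ! i)" "y = (\<Sum>i<length p. d i *\<^sub>R p ! i)"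
      by (auto simp: V_def)
    then show "x + y \<in> V" unfolding V_def
      by (intro range_eqI[of _ _ "\<lambda>i. c i + d i"]) (simp add: scaleR_left_distrib sum.distrib)
  next
    fix x and t :: real assume "x \<in> V"
    then obtain c where "x = (\<Sum>i<length p. c i *\<^sub>R p ! i)" by (auto simp: V_def)
    then show "t *\<^sub>R x \<in> V" unfolding V_def
      by (intro range_eqI[of _ _ "\<lambda>i. t * c i"]) (simp add: scaleR_sum_right)
  qed
  moreover have "set p \<subseteq> V"
  proof
    fix x assume "x \<in> set p"
    then obtain i where "i < length p" "x = p ! i" by (auto simp: in_set_conv_nth)
    then show "x \<in> V" unfolding V_def
      by (intro range_eqI[of _ _ "\<lambda>j. if j = i then 1 else 0"])
        (simp add: if_distrib[of "\<lambda>c. c *\<^sub>R _"] cong: if_cong)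
  qed
  ultimately have "v \<in> V" using assms span_minimal by blast
  then show thesis using that by (auto simp: V_def)
qed

lemma reformulation_replace:
  fixes p :: "'n::finite sdp"
  assumes i: "i < length p" "c i \<noteq> 0" and len: "2 \<le> length p"
  shows "reformulation p (p[i := \<Sum>j<length p. c j *\<^sub>R p ! j])"
proof -
  have "reformulation p (p[i := c i *\<^sub>R p ! i + (\<Sum>j\<in>J. c j *\<^sub>R p ! j)])"
    if "finite J" "J \<subseteq> {..<length p} - {i}" for J
    using that
  proof (induction J rule: finite_induct)
    case empty
    \<comment> \<open>Scaling alone is a \<open>combine\<close> with \<open>mu = 0\<close>, which
      needs a second row as partner; hence the bound on the length.\<close>
    define j where "j = (if i = 0 then 1 else 0 :: nat)"
    have "j < length p" "i \<noteq> j" using len by (auto simp: j_def)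
    then have "reform_step p (p[i := c i *\<^sub>R (p ! i) + 0 *\<^sub>R (p ! j)])"
      using i by (intro reform_step.combine)
    then show ?case by (simp add: reformulation_def)
  next
    case (insert j J)
    define q where "q = p[i := c i *\<^sub>R p ! i + (\<Sum>j\<in>J. c j *\<^sub>R p ! j)]"
    have j: "j < length p" "i \<noteq> j" using insert.prems by auto
    then have "reform_step q (q[i := 1 *\<^sub>R (q ! i) + c j *\<^sub>R (q ! j)])"
      using i by (intro reform_step.combine) (auto simp: q_def)
    moreover have "q[i := 1 *\<^sub>R (q ! i) + c j *\<^sub>R (q ! j)]
        = p[i := c i *\<^sub>R p ! i + (\<Sum>j\<in>insert j J. c j *\<^sub>R p ! j)]"
      using j i(1) insert.hyps by (simp add: q_def add_ac)
    moreover have "reformulation p q" using insert by (simp add: q_def)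
    ultimately show ?case unfolding reformulation_def by (metis rtranclp.rtrancl_into_rtrancl)
  qed
  from this[of "{..<length p} - {i}"] show ?thesis
    using i(1) by (simp add: sum.remove[of "{..<length p}" i])
qed

lemma span_set_update:
  fixes p :: "'a::real_vector list"
  assumes i: "i < length p" "c i \<noteq> 0" and v: "v = (\<Sum>j<length p. c j *\<^sub>R p ! j)"
  shows "span (set (p[i := v])) = span (set p)"
proof (rule subset_antisym)
  have "v \<in> span (set p)" unfolding v by (intro span_sum span_scale span_base) simp
  then have "set (p[i := v]) \<subseteq> span (set p)"
    using set_update_subset_insert[of p i v] span_superset[of "set p"] by blast
  then show "span (set (p[i := v])) \<subseteq> span (set p)" by (simp add: span_minimal)
  have other: "p ! j \<in> span (set (p[i := v]))" if "j < length p" "j \<noteq> i" for j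
    using that nth_mem[of j "p[i := v]"] by (intro span_base) simp
  have "v \<in> span (set (p[i := v]))" using i(1) by (intro span_base) (simp add: set_update_memI)
  moreover have "(\<Sum>j\<in>{..<length p} - {i}. c j *\<^sub>R p ! j) \<in> span (set (p[i := v]))"
    using other by (intro span_sum span_scale) auto
  moreover have "p ! i = (1 / c i) *\<^sub>R (v - (\<Sum>j\<in>{..<length p} - {i}. c j *\<^sub>R p ! j))"
    using i by (simp add: v sum.remove[of "{..<length p}" i])
  ultimately have "p ! i \<in> span (set (p[i := v]))" by (simp add: span_diff span_scale)
  then have "set p \<subseteq> span (set (p[i := v]))"
    using other by (metis in_set_conv_nth subsetI)
  then show "span (set p) \<subseteq> span (set (p[i := v]))" by (simp add: span_minimal)
qed

text \<open>Steinitz exchange by row operations: \<open>v (s + 1)\<close> is independent of its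
  predecessors in the first \<open>s\<close> positions, so it involves some later row; it replaces
  that row and is exchanged into position \<open>s\<close>. List positions start at 0, the sequence
  at 1.\<close>

lemma reformulation_exchange_basis:
  fixes p :: "'n::finite sdp"
  assumes len: "2 \<le> length p"
    and v: "\<And>i. i \<in> {1..s} \<Longrightarrow> v i \<in> span (set p) \<and> v i \<notin> span (v ` {1..<i})"
  shows "\<exists>q. reformulation p q \<and> length q = length p \<and> s \<le> length p \<and>
    (\<forall>i<s. q ! i = v (i + 1)) \<and> span (set q) = span (set p)"
  using v
proof (induction s)
  case 0
  show ?case by (rule exI[of _ p]) (simp add: reformulation_def)
next
  case (Suc s)
  then obtain q where q: "reformulation p q" "length q = length p" "s \<le> length p"
    "\<And>i. i < s \<Longrightarrow> q ! i = v (i + 1)" "span (set q) = span (set p)" by auto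
  have w: "v (s + 1) \<in> span (set q)" "v (s + 1) \<notin> span (v ` {1..<s + 1})"
    using Suc.prems[of "s + 1"] q(5) by auto
  obtain c where c: "v (s + 1) = (\<Sum>j<length q. c j *\<^sub>R q ! j)" using span_set_nth[OF w(1)] .
  have "\<exists>i. s \<le> i \<and> i < length q \<and> c i \<noteq> 0"
  proof (rule ccontr)
    assume none: "\<nexists>i. s \<le> i \<and> i < length q \<and> c i \<noteq> 0"
    have "c j *\<^sub>R q ! j \<in> span (v ` {1..<s + 1})" if "j < length q" for j
    proof (cases "j < s")
      case True
      then show ?thesis using q(4) by (intro span_scale span_base) auto
    next
      case False
      then have "c j = 0" using none that by auto
      then show ?thesis by (simp add: span_zero)
    qed
    then have "v (s + 1) \<in> span (v ` {1..<s + 1})" unfolding c by (intro span_sum) simp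
    then show False using w(2) by contradiction
  qed
  then obtain i where i: "s \<le> i" "i < length q" "c i \<noteq> 0" by blast
  define r where "r = q[i := v (s + 1)]"
  have r: "reformulation q r" "span (set r) = span (set q)" "length r = length q"
    using reformulation_replace[of i q c, folded c] span_set_update[OF i(2), of c, OF i(3) c] i(2,3) len q(2)
    by (simp_all add: r_def)
  define r' where "r' = r[s := r ! i, i := r ! s]"
  have "reformulation r r'"
  proof (cases "s = i")
    case True
    then show ?thesis by (simp add: r'_def reformulation_def)
  next
    case False
    then have "reform_step r r'" unfolding r'_def using i r(3) by (intro reform_step.exchange) auto
    then show ?thesis by (simp add: reformulation_def)
  qed
  moreover have "set r' = set r" using set_swap[of s r i] i r(3) by (simp add: r'_def)
  moreover have "r' ! j = v (j + 1)" if "j < Suc s" for j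
    using that i q(4)[of j] by (auto simp: r'_def r_def nth_list_update less_Suc_eq)
  moreover have "reformulation p r" using q(1) r(1) by (rule reformulation_trans)
  moreover have "length r' = length p" using r(3) q(2) by (simp add: r'_def)
  moreover have "Suc s \<le> length p" using i q(2) by simp
  ultimately show ?case using r(2) q(5) reformulation_trans by (intro exI[of _ r']) auto
qed

section \<open>Completeness\<close>

lemma flag_neqI:
  assumes "1 \<le> i" "v \<in> flag M (i - 1)" "v \<bullet> (M i *v v) \<noteq> 0"
  shows "flag M i \<noteq> flag M (i - 1)"
  using flag_orth[OF assms(1) _ assms(2), of v] assms(2,3) by blast

lemma wi_output_complete:
  fixes p :: "'n::finite sdp"
  assumes sdp: "is_sdp p" and wi: "weakly_infeasible p"
  shows "wi_output p"
proof -
  have disj: "affine_set p \<inter> psd_cone = {}" and ne: "affine_set p \<noteq> {}"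
    and near: "\<And>\<epsilon>. \<epsilon> > 0 \<Longrightarrow> \<exists>x\<in>affine_set p. \<exists>z\<in>psd_cone. dist x z < \<epsilon>"
    using wi unfolding weakly_infeasible_iff by auto
  obtain x0 where x0: "x0 \<in> affine_set p" using ne by blast
  define As where "As = fst ` set p"
  define N where "N = {X. sym_mat X \<and> (\<forall>A\<in>As. A \<bullet>\<^sub>S X = 0)}"
  have symA: "sym_mat A" if "A \<in> As" for A using sdp that by (auto simp: As_def is_sdp_def)
  have sym_span: "sym_mat Y" if "Y \<in> span As" for Y
    using that span_minimal[of As, OF _ subspace_sym_mat] symA by blast
  have N: "subspace N"
    by (auto simp: N_def subspace_def sym_mat_0 sym_mat_add sym_mat_scaleR mat_prod_add_right
        mat_prod_scaleR_right mat_prod_commute[of _ 0] mat_prod_zero_left)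
  have aff: "X \<in> affine_set p \<longleftrightarrow> sym_mat X \<and> (\<forall>A\<in>As. A \<bullet>\<^sub>S X = A \<bullet>\<^sub>S x0)" for X
    using x0 by (force simp: affine_set_def As_def)
  have aff_N: "x0 + n \<in> affine_set p" if "n \<in> N" for n
    using that aff x0 by (auto simp: N_def mat_prod_add_right sym_mat_add)
  have N_aff: "X - x0 \<in> N" if "X \<in> affine_set p" for X
  proof -
    have "A \<bullet>\<^sub>S (X - x0) = 0" if "A \<in> As" for A
      using aff[of X] \<open>X \<in> affine_set p\<close> that mat_prod_add_right[of A "X - x0" x0] by simp
    then show ?thesis using aff[of X] aff[of x0] x0 that by (auto simp: N_def sym_mat_diff)
  qed
  have span_N: "Y \<bullet>\<^sub>S X = 0" if "Y \<in> span As" "X \<in> N" for Y X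
    using that(1) by (induction rule: span_induct_alt)
      (use that(2) in \<open>auto simp: N_def mat_prod_zero_left mat_prod_add_left mat_prod_scaleR_left\<close>)
  have span_aff: "Y \<bullet>\<^sub>S X = Y \<bullet>\<^sub>S x0" if "Y \<in> span As" "X \<in> affine_set p" for Y X
    using span_N[OF that(1) N_aff[OF that(2)]] mat_prod_add_right[of Y "X - x0" x0] by simp

  have infeasible: "\<exists>A\<in>As. A \<bullet> Z \<noteq> A \<bullet> x0" if "Z \<in> psd_cone" for Z
  proof (rule ccontr)
    assume "\<not> ?thesis"
    then have "Z \<in> affine_set p" using that symA by (auto simp: aff mat_prod_inner psd_cone_iff)
    then show False using disj that by blast
  qed
  \<comment> \<open>A combination \<open>Y\<close> of the constraints has the right-hand side
    \<open>Y \<bullet>\<^sub>S x0\<close>. \<open>MidA\<close> thus collects homogeneous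
    consequences, \<open>FinA\<close> those with the right-hand side -1 required of
    \<open>A (k + 1)\<close>.\<close>
  define FinA where "FinA = (\<lambda>Y. Y \<in> span As \<and> Y \<bullet>\<^sub>S x0 = -1)"
  define MidA where "MidA = (\<lambda>Y. Y \<in> span As \<and> Y \<bullet>\<^sub>S x0 = 0)"
  have "(\<exists>Y. FinA Y \<and> psd_on S Y) \<or> (\<exists>Y. MidA Y \<and> psd_on S Y \<and> (\<exists>v\<in>S. v \<bullet> (Y *v v) \<noteq> 0))"
    for S :: "(real^'n) set"
    using facial_reduction_alternative[of As x0 S, OF infeasible] sym_span
    by (auto simp: FinA_def MidA_def mat_prod_inner)
  moreover have "sym_mat Y" if "MidA Y \<or> FinA Y" for Y
    using that sym_span by (auto simp: FinA_def MidA_def)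
  ultimately obtain k A where A: "fr_seq (k + 1) A" "FinA (A (k + 1))"
    "\<And>i. i \<in> {1..k} \<Longrightarrow> MidA (A i) \<and> (\<exists>v\<in>flag A (i - 1). v \<bullet> (A i *v v) \<noteq> 0)"
    using fr_seq_exists[of MidA FinA] by blast
  have near': "\<exists>n\<in>N. \<exists>z\<in>psd_cone. dist (x0 + n) z < \<epsilon>" if \<epsilon>: "0 < \<epsilon>" for \<epsilon>
  proof -
    obtain x z where "x \<in> affine_set p" "z \<in> psd_cone" "dist x z < \<epsilon>" using near[OF \<epsilon>] by blast
    then show ?thesis using N_aff[of x] by (intro bexI[of _ "x - x0"] bexI[of _ z]) auto
  qed
  have "(\<exists>Y. Y \<in> affine_set p \<and> psd_on S Y) \<or> (\<exists>Y. Y \<in> N \<and> psd_on S Y \<and> (\<exists>v\<in>S. v \<bullet> (Y *v v) \<noteq> 0))"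
    if "subspace S" for S
    using dual_facial_reduction_alternative[OF N _ affine_setD(1)[OF x0] that near'] aff_N
    by (auto simp: N_def)
  moreover have "sym_mat Y" if "Y \<in> N \<or> Y \<in> affine_set p" for Y
    using that affine_setD(1)[of Y p] by (auto simp: N_def)
  ultimately obtain l X where X: "fr_seq (l + 1) X" "X (l + 1) \<in> affine_set p"
    "\<And>j. j \<in> {1..l} \<Longrightarrow> X j \<in> N \<and> (\<exists>v\<in>flag X (j - 1). v \<bullet> (X j *v v) \<noteq> 0)"
    using fr_seq_exists[of "\<lambda>Y. Y \<in> N" "\<lambda>Y. Y \<in> affine_set p"] by blast
  obtain T S :: "real^'n^'n" and P Q where TS: "transpose S ** T = mat 1"
    and eA: "echelon_struct (k + 1) (\<lambda>i. transpose T ** A i ** T) P"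
    and eX: "echelon_struct (l + 1) (\<lambda>j. transpose S ** X j ** S) Q"
    and neP: "\<And>i. i \<in> {1..k + 1} \<Longrightarrow> flag A i \<noteq> flag A (i - 1) \<Longrightarrow> P i \<noteq> {}"
    and neQ: "\<And>j. j \<in> {1..l + 1} \<Longrightarrow> flag X j \<noteq> flag X (j - 1) \<Longrightarrow> Q j \<noteq> {}"
    by (rule simultaneous_echelon[OF A(1) X(1)]) (rule that)
  define A' where "A' = (\<lambda>i. transpose T ** A i ** T)"
  define X' where "X' = (\<lambda>j. transpose S ** X j ** S)"
  note eA = eA[folded A'_def] and eX = eX[folded X'_def]
  have A_span: "A i \<in> span As" "A i \<bullet>\<^sub>S x0 = (if i = k + 1 then - 1 else 0)" if "i \<in> {1..k + 1}" for i
    using A(2) A(3)[of i] that by (cases "i = k + 1"; simp add: FinA_def MidA_def)+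
  have prod: "A' i \<bullet>\<^sub>S X' j = (if (i, j) = (k + 1, l + 1) then - 1 else 0)"
    if "i \<in> {1..k + 1}" "j \<in> {1..l + 1}" for i j
  proof -
    have "A' i \<bullet>\<^sub>S X' j = A i \<bullet>\<^sub>S X j" unfolding A'_def X'_def by (rule mat_prod_congruence[OF TS])
    then show ?thesis
      using span_aff[OF A_span(1)[OF that(1)] X(2)] A_span(2)[OF that(1)]
        span_N[OF A_span(1)[OF that(1)]] X(3)[of j] that by (cases "j = l + 1") auto
  qed
  have prod': "X' j \<bullet>\<^sub>S A' i = (if (i, j) = (k + 1, l + 1) then - 1 else 0)"
    if "i \<in> {1..k + 1}" "j \<in> {1..l + 1}" for i j
    using prod[OF that] by (simp add: mat_prod_commute)
  \<comment> \<open>For \<open>k = 0\<close> the last matrix would be \<open>A' 1\<close>, whose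
    products with \<open>X' 1, ..., X' l\<close> vanish; its product with \<open>X' (l + 1)\<close>
    would then be nonnegative, not -1. The bound on \<open>l\<close> is symmetric.\<close>
  have "1 \<le> k"
  proof (rule ccontr)
    assume "\<not> 1 \<le> k"
    then have "0 \<le> A' 1 \<bullet>\<^sub>S X' (l + 1)"
      using prod by (intro echelon_first_disjoint(2)[OF eA _ eX]) auto
    then show False using prod[of 1 "l + 1"] \<open>\<not> 1 \<le> k\<close> by simp
  qed
  have "1 \<le> l"
  proof (rule ccontr)
    assume "\<not> 1 \<le> l"
    then have "0 \<le> X' 1 \<bullet>\<^sub>S A' (k + 1)"
      using prod' by (intro echelon_first_disjoint(2)[OF eX _ eA]) auto
    then show False using prod'[of "k + 1" 1] \<open>\<not> 1 \<le> l\<close> by simp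
  qed
  have P1: "P 1 \<inter> Q j = {}" if "j \<in> {1..l + 1}" for j
    by (rule echelon_first_disjoint(1)[OF eA _ eX, of "l + 1"]) (use prod \<open>1 \<le> k\<close> that in auto)
  have Q1: "Q 1 \<inter> P i = {}" if "i \<in> {1..k + 1}" for i
    by (rule echelon_first_disjoint(1)[OF eX _ eA, of "k + 1"]) (use prod' \<open>1 \<le> l\<close> that in auto)
  have "P i \<noteq> {}" if i: "i \<in> {1..k}" for i
  proof -
    obtain v where "v \<in> flag A (i - 1)" "v \<bullet> (A i *v v) \<noteq> 0" using A(3)[OF i] by blast
    then have "flag A i \<noteq> flag A (i - 1)" using i by (intro flag_neqI) auto
    then show ?thesis using neP[of i] i by simp
  qed
  moreover have "Q j \<noteq> {}" if j: "j \<in> {1..l}" for j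
  proof -
    obtain v where "v \<in> flag X (j - 1)" "v \<bullet> (X j *v v) \<noteq> 0" using X(3)[OF j] by blast
    then have "flag X j \<noteq> flag X (j - 1)" using j by (intro flag_neqI) auto
    then show ?thesis using neQ[of j] j by simp
  qed
  ultimately have init: "bea_init k l P Q A' X'" using eA eX P1 Q1 unfolding bea_init_def by blast
  have "base_eqs k l A' X'" using prod by (simp add: base_eqs_def base_eq_def)
  then have out: "bea_output k l A' X'"
    using bea_run_constant[OF init, of "k + 1"] unfolding bea_output_def by auto

  define v where "v = (\<lambda>i. (A i, A i \<bullet>\<^sub>S x0))"
  have v_span: "v i \<in> span (set p)" if "i \<in> {1..k + 1}" for i
  proof -
    define L where "L = (\<lambda>A :: real^'n^'n. (A, A \<bullet>\<^sub>S x0))"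
    have "linear L" by (intro linearI) (simp_all add: L_def mat_prod_add_left mat_prod_scaleR_left)
    then have "L ` span As = span (L ` As)" by (simp add: linear_span_image)
    moreover have "L ` As = set p" using x0 by (force simp: L_def As_def affine_set_def image_iff)
    ultimately show ?thesis using A_span(1)[OF that] by (auto simp: v_def L_def)
  qed
  \<comment> \<open>For \<open>i \<le> k\<close>, some vector of \<open>flag A (i - 1)\<close> is
    not null for \<open>A i\<close>, whereas it is null for all earlier forms; the last pair is
    separated from the others by its right-hand side.\<close>
  have v_indep: "v i \<notin> span (v ` {1..<i})" if i: "i \<in> {1..k + 1}" for i
  proof (cases "i = k + 1")
    case True
    have "span (v ` {1..<i}) \<subseteq> {q. snd q = 0}"
      using A_span(2) i True by (intro span_minimal) (auto simp: v_def subspace_def)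
    then show ?thesis using A_span(2)[OF i] True by (auto simp: v_def)
  next
    case False
    then have i': "i \<in> {1..k}" using i by simp
    obtain w where w: "w \<in> flag A (i - 1)" "w \<bullet> (A i *v w) \<noteq> 0" using A(3)[OF i'] by blast
    have "w \<bullet> (A j *v w) = 0" if "j \<in> {1..<i}" for j
    proof (rule flag_orth)
      have "j \<le> i - 1" "j - 1 \<le> i - 1" using that by auto
      then show "w \<in> flag A j" "w \<in> flag A (j - 1)" using w(1) flag_antimono by blast+
    qed (use that in simp)
    then have "span (v ` {1..<i}) \<subseteq> {q. w \<bullet> (fst q *v w) = 0}"
      by (intro span_minimal)
        (auto simp: v_def subspace_def matrix_vector_mult_add_rdistrib inner_add_right scaleR_matrix_vector)
    then show ?thesis using w(2) by (auto simp: v_def)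
  qed
  have "2 \<le> length p"
  proof -
    have v2: "v 2 \<notin> span {v 1}"
      using v_indep[of 2] \<open>1 \<le> k\<close> by (simp add: atLeastLessThan_nat_numeral)
    then have ne: "v 2 \<noteq> v 1" by (auto simp: span_base)
    have "v 1 \<noteq> 0" using v_indep[of 1] by (auto simp: span_zero)
    then have "independent {v 2, v 1}" using v2 by (intro independent_insertI) (auto simp: independent_empty)
    then have "card {v 2, v 1} \<le> card (set p)"
      using independent_span_bound[of "set p" "{v 2, v 1}"] v_span \<open>1 \<le> k\<close> by simp
    then show ?thesis using ne card_length[of p] by simp
  qed
  then obtain q where q: "reformulation p q" "length q = length p" "k + 1 \<le> length p"
    "\<And>i. i < k + 1 \<Longrightarrow> q ! i = v (i + 1)" "span (set q) = span (set p)"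
    using reformulation_exchange_basis[of p "k + 1" v] v_span v_indep by blast
  have q_span: "fst (q ! i) \<in> span As \<and> snd (q ! i) = fst (q ! i) \<bullet>\<^sub>S x0" if "i < length p" for i
  proof -
    have "span (set p) \<subseteq> {q. fst q \<in> span As \<and> snd q = fst q \<bullet>\<^sub>S x0}"
    proof (rule span_minimal)
      show "set p \<subseteq> {q. fst q \<in> span As \<and> snd q = fst q \<bullet>\<^sub>S x0}"
        using x0 by (auto simp: As_def affine_set_def intro!: span_base)
      show "subspace {q. fst q \<in> span As \<and> snd q = fst q \<bullet>\<^sub>S x0}"
        by (auto simp: subspace_def span_zero span_add span_scale mat_prod_zero_left
            mat_prod_add_left mat_prod_scaleR_left)
    qed
    moreover have "q ! i \<in> span (set p)" using q(2,5) that span_base[of "q ! i" "set q"] by simp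
    ultimately show ?thesis by blast
  qed
  \<comment> \<open>Positions in \<open>q\<close> start at 0, the sequence \<open>B\<close> at 1.
    The rows beyond \<open>k + 1\<close> stay in the span of the constraints and are therefore
    orthogonal to the directions \<open>X 1, ..., X l\<close>.\<close>
  define B where "B = (\<lambda>i. transpose T ** fst (q ! (i - 1)) ** T)"
  define m where "m = length p"
  have BX: "B (i + 1) \<bullet>\<^sub>S X' j = fst (q ! i) \<bullet>\<^sub>S X j" for i j
    unfolding B_def X'_def by (simp add: mat_prod_congruence[OF TS])
  have BA: "B i = A' i" if "i \<in> {1..k + 1}" for i
    using q(4)[of "i - 1"] that by (auto simp: B_def A'_def v_def)
  have step3: "wi_step3 m k l A' X' B"
    unfolding wi_step3_def
  proof (intro conjI ballI)
    fix i assume "i \<in> {k + 2..m}"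
    then obtain h where h: "i = h + 1" "h < length p" by (cases i) (auto simp: m_def)
    have hs: "fst (q ! h) \<in> span As" using q_span[OF h(2)] by simp
    show "sym_mat (B i)" using sym_span[OF hs] h(1) by (simp add: B_def sym_mat_congruence)
    show "B i \<bullet>\<^sub>S X' j = 0" if "j \<in> {1..l}" for j
      using span_N[OF hs] X(3)[OF that] BX h(1) by simp
  qed (use BA in blast)
  have "invertible T" using TS matrix_left_right_inverse unfolding invertible_def by metis
  then have "reform_step q (map (\<lambda>(A, b). (transpose T ** A ** T, b)) q)" by (rule reform_step.congruence)
  moreover have "map (\<lambda>(A, b). (transpose T ** A ** T, b)) q = wi_data m k l B X'"
  proof (rule nth_equalityI)
    show "length (map (\<lambda>(A, b). (transpose T ** A ** T, b)) q) = length (wi_data m k l B X')"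
      by (simp add: wi_data_def m_def q(2) del: upt_Suc)
    fix i assume "i < length (map (\<lambda>(A, b). (transpose T ** A ** T, b)) q)"
    then have i: "i < length p" using q(2) by simp
    have "snd (q ! i) = wi_rhs k l B X' (i + 1)"
    proof (cases "i < k + 1")
      case True
      then show ?thesis using q(4)[OF True] A_span(2)[of "i + 1"] by (simp add: v_def wi_rhs_def)
    next
      case False
      then show ?thesis using q_span[OF i] span_aff[OF _ X(2)] BX[of i "l + 1"] by (simp add: wi_rhs_def)
    qed
    then show "map (\<lambda>(A, b). (transpose T ** A ** T, b)) q ! i = wi_data m k l B X' ! i"
      using i q(2) by (simp add: wi_data_def m_def B_def split_beta del: upt_Suc)
  qed
  ultimately have "reformulation p (wi_data m k l B X')"
    using q(1) unfolding reformulation_def by (metis rtranclp.rtrancl_into_rtrancl)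
  then have "reformulation (wi_data m k l B X') p" by (rule reformulation_sym)
  moreover have "wi_step1 m k l A' X'"
    using \<open>1 \<le> k\<close> \<open>1 \<le> l\<close> q(3) out by (simp add: wi_step1_def m_def)
  ultimately show ?thesis using step3 unfolding wi_output_def by blast
qed

theorem theorem3:
  shows
    (* the initial choice of the Base Equations Algorithm is possible *)
    "(\<forall>k l. 1 \<le> k \<and> k < CARD('n::finite) \<and> 1 \<le> l \<and> l < CARD('n) \<longrightarrow>
        (\<exists>(P :: nat \<Rightarrow> 'n set) Q A X. bea_init k l P Q A X)) \<and>
     \<comment> \<open>no earlier choice blocks an iteration of its loop\<close>
     (\<forall>k l (P :: nat \<Rightarrow> 'n set) Q t A X.
        1 \<le> k \<and> 1 \<le> l \<and> bea_run k l P Q t A X \<and> t + 1 \<le> k + 1 \<longrightarrow>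
        (\<exists>A' X'. bea_iter k l P Q (t + 1) A X A' X')) \<and>
     \<comment> \<open>it delivers what the first step of the construction asks for\<close>
     (\<forall>m k l (A :: nat \<Rightarrow> real^'n^'n) X. wi_step1 m k l A X \<longrightarrow>
        echelon (k + 1) A \<and> echelon (l + 1) X \<and> base_eqs k l A X) \<and>
     \<comment> \<open>the remaining choice is possible\<close>
     (\<forall>m k l (A :: nat \<Rightarrow> real^'n^'n) X. wi_step1 m k l A X \<longrightarrow> (\<exists>A'. wi_step3 m k l A X A')) \<and>
     \<comment> \<open>every output is a weakly infeasible system\<close>
     (\<forall>p :: 'n sdp. wi_output p \<longrightarrow> is_sdp p \<and> weakly_infeasible p) \<and>
     \<comment> \<open>every weakly infeasible system is an output\<close>
     (\<forall>p :: 'n sdp. is_sdp p \<and> weakly_infeasible p \<longrightarrow> wi_output p)"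
proof (intro conjI allI impI; (elim conjE)?)
  show "\<exists>(P :: nat \<Rightarrow> 'n set) Q A X. bea_init k l P Q A X"
    if "1 \<le> k" "k < CARD('n)" "1 \<le> l" "l < CARD('n)" for k l
    using that by (rule bea_init_exists)
  show "\<exists>A' X'. bea_iter k l P Q (t + 1) A X A' X'"
    if "1 \<le> k" "1 \<le> l" "bea_run k l P Q t A X" "t + 1 \<le> k + 1"
    for k l and P Q :: "nat \<Rightarrow> 'n set" and t A X
    using bea_iter_exists[OF bea_run_inv[OF that(3,1,2)] that(4,2)] .
  fix m k l and A X :: "nat \<Rightarrow> real^'n^'n"
  assume s: "wi_step1 m k l A X"
  then obtain P Q where init: "bea_init k l P Q A X" and base: "base_eqs k l A X" by (rule wi_step1_inv)
  show "echelon (k + 1) A" "echelon (l + 1) X" "base_eqs k l A X"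
    using bea_initD(1,2)[OF init] base by (auto simp: echelon_def)
  show "\<exists>A'. wi_step3 m k l A X A'"
    by (rule exI[of _ "\<lambda>i. if i \<le> k + 1 then A i else 0"])
      (auto simp: wi_step3_def sym_mat_0 mat_prod_zero_left)
next
  fix p :: "'n sdp"
  show "is_sdp p" "weakly_infeasible p" if "wi_output p" using wi_output_sound[OF that] by simp_all
  show "wi_output p" if "is_sdp p" "weakly_infeasible p" using that by (rule wi_output_complete)
qed

end
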